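(* Let $G$ be a metric graph. Then there exists a measure $\mu$ of the form $$\mu=\tfrac12\delta_x+\tfrac12\delta_y$$ for two points $x\ne y\in G$ such that $\lambda_1^{\min}(G)=\lambda_1(H_\mu)$. Moreover, every Borel probability measure $\mu$ on $G$ with $\lambda_1^{\min}(G)=\lambda_1(H_\mu)$ is of the form $\frac12\delta_x+\frac12\delta_y$ for some points $x\neq y\in G$.
   Context: A metric graph $G=(V,E,\ell)$ is given by a finite connected graph $(V,E)$ with at least one edge (loops and multiple edges allowed) and edge lengths $\ell:E\to(0,\infty)$: each edge $e$ is (after choosing an orientation) identified with the interval $[0,\ell(e)]$, and $G$ is the compact topological space obtained by gluing endpoints of edges corresponding to the same vertex. $dx$ is the Lebesgue measure on $G$. $H^1(G)$ is the space of continuous $f:G\to\mathbb{R}$ whose restriction to every open edge lies in $H^1((0,\ell(e)))$; $q(f,g)=\int_G f'g'\,dx$. A function $f\in H^1(G)$ is harmonic on an open set $O\subset G$ if $q(f,g)=0$ for all $g\in H^1(G)$ with $g\equiv 0$ on $G\setminus O$. For a Borel probability measure $\mu$ on $G$, let $H^1(G,\mu)=\{f\in H^1(G): f \text{ harmonic on } G\setminus\operatorname{supp}\mu\}$, regarded (injectively) as a dense subspace of $L^2(G,\mu)$. $H_\mu$ is the non-negative self-adjoint operator in $L^2(G,\mu)$ associated with the closed form $q|_{H^1(G,\mu)}$: $f\in\operatorname{dom}(H_\mu)$ and $H_\mu f=g$ iff $f\in H^1(G,\mu)$ and $q(f,\varphi)=\int_G g\varphi\,d\mu$ for all $\varphi\in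 H^1(G,\mu)$. Its spectrum is discrete; its eigenvalues, counted with multiplicity, are $0=\lambda_0(H_\mu)<\lambda_1(H_\mu)\le\lambda_2(H_\mu)\le\cdots$, with the convention $\lambda_k(H_\mu):=+\infty$ for $k\ge\dim L^2(G,\mu)$. Let $\lambda_k^{\min}(G):=\min_{\mu}\lambda_k(H_\mu)$, the minimum being over all Borel probability measures $\mu$ on $G$ (it is attained). $\delta_x$ is the Dirac measure at $x$. *)

theory Defs
  imports
    "HOL-Probability.Probability"
    "HOL-Library.Function_Algebras"
    "Graph_Theory.Digraph_Component"
begin

section \<open>The Sobolev space of an interval\<close>

definition C1_compact_support :: "real \<Rightarrow> (real \<Rightarrow> real) \<Rightarrow> bool" where
  "C1_compact_support L \<phi> \<longleftrightarrow> \<phi> C1_differentiable_on UNIV \<and>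
     (\<exists>a b. 0 < a \<and> b < L \<and> (\<forall>t. t \<notin> {a..b} \<longrightarrow> \<phi> t = 0))"

definition L2 :: "'a measure \<Rightarrow> ('a \<Rightarrow> real) set" where
  "L2 M = {f \<in> borel_measurable M. integrable M (\<lambda>x. (f x)\<^sup>2)}"

definition weak_derivative :: "real \<Rightarrow> (real \<Rightarrow> real) \<Rightarrow> (real \<Rightarrow> real) \<Rightarrow> bool" where
  "weak_derivative L u g \<longleftrightarrow> g \<in> L2 (lebesgue_on {0<..<L}) \<and>
     (\<forall>\<phi>. C1_compact_support L \<phi> \<longrightarrow>
        (\<integral>t. u t * deriv \<phi> t \<partial>lebesgue_on {0<..<L}) = - (\<integral>t. g t * \<phi> t \<partial>lebesgue_on {0<..<L}))"

definition H1_interval :: "real \<Rightarrow> (real \<Rightarrow> real) set" where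
  "H1_interval L = {u \<in> L2 (lebesgue_on {0<..<L}). \<exists>g. weak_derivative L u g}"

text \<open>A representative of the weak derivative, which is unique up to null sets.\<close>

definition wderiv :: "real \<Rightarrow> (real \<Rightarrow> real) \<Rightarrow> real \<Rightarrow> real" where
  "wderiv L u = (SOME g. weak_derivative L u g)"

section \<open>Dimensions of function spaces\<close>

global_interpretation real_fun: vector_space "\<lambda>(c::real) (f::'a \<Rightarrow> real) x. c * f x"
  by unfold_locales (auto simp: fun_eq_iff algebra_simps)

text \<open>The dimension of the space of classes of square integrable functions modulo equality
  almost everywhere.\<close>

definition L2_dim :: "'a measure \<Rightarrow> enat" where
  "L2_dim M = Sup {enat n | n. \<exists>F :: nat \<Rightarrow> 'a \<Rightarrow> real. (\<forall>i<n. F i \<in> L2 M) \<and>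
     (\<forall>c :: nat \<Rightarrow> real. (AE x in M. (\<Sum>i<n. c i * F i x) = 0) \<longrightarrow> (\<forall>i<n. c i = 0))}"

section \<open>Metric graphs\<close>

text \<open>The arcs of the digraph are the edges with a chosen orientation; loops and multiple arcs are
  allowed. \<^const>\<open>Digraph_Component.connected\<close> disregards the orientation and requires
  a nonempty set of vertices.\<close>

locale metric_graph = fin_digraph G for G :: "('v, 'e) pre_digraph" (structure) +
  fixes len :: "'e \<Rightarrow> real"
  assumes connected_graph: "Digraph_Component.connected G"
    and arcs_nonempty: "arcs G \<noteq> {}"
    and len_pos: "e \<in> arcs G \<Longrightarrow> 0 < len e"

text \<open>Normal forms for the points of the disjoint union of the intervals \<open>[0, len e]\<close> modulo the
  gluing of endpoints: a point is a vertex, or lies on the open edge \<open>e\<close> at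
  distance \<open>t \<in> (0, len e)\<close> from the tail of \<open>e\<close>.\<close>

datatype ('v, 'e) mg_point = Vertex 'v | Inner 'e real

context metric_graph
begin

definition points :: "('v, 'e) mg_point set" where
  "points = Vertex ` verts G \<union> {Inner e t | e t. e \<in> arcs G \<and> 0 < t \<and> t < len e}"

definition edge_map :: "'e \<Rightarrow> real \<Rightarrow> ('v, 'e) mg_point" where
  "edge_map e t =
     (if t = 0 then Vertex (tail G e) else if t = len e then Vertex (head G e) else Inner e t)"

text \<open>The quotient topology, i.e. the final topology for the edge maps.\<close>

definition mg_topology :: "('v, 'e) mg_point topology" where
  "mg_topology = topology (\<lambda>U. U \<subseteq> points \<and>
     (\<forall>e\<in>arcs G. openin (top_of_set {0..len e}) {t \<in> {0..len e}. edge_map e t \<in> U}))"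

lemma openin_mg_topology:
  "openin mg_topology U \<longleftrightarrow> U \<subseteq> points \<and>
     (\<forall>e\<in>arcs G. openin (top_of_set {0..len e}) {t \<in> {0..len e}. edge_map e t \<in> U})"
proof -
  have "istopology (\<lambda>U. U \<subseteq> points \<and>
     (\<forall>e\<in>arcs G. openin (top_of_set {0..len e}) {t \<in> {0..len e}. edge_map e t \<in> U}))"
    unfolding istopology_def
  proof (intro conjI allI impI, goal_cases)
    case (2 S T)
    show ?case
    proof
      fix e assume "e \<in> arcs G"
      then have "openin (top_of_set {0..len e})
        ({t \<in> {0..len e}. edge_map e t \<in> S} \<inter> {t \<in> {0..len e}. edge_map e t \<in> T})"
        using 2 by (intro openin_Int) auto
      moreover have "{t \<in> {0..len e}. edge_map e t \<in> S} \<inter> {t \<in> {0..len e}. edge_map e t \<in> T}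
        = {t \<in> {0..len e}. edge_map e t \<in> S \<inter> T}" by auto
      ultimately show "openin (top_of_set {0..len e}) {t \<in> {0..len e}. edge_map e t \<in> S \<inter> T}"
        by simp
    qed
  next
    case (4 \<K>)
    show ?case
    proof
      fix e assume "e \<in> arcs G"
      then have "openin (top_of_set {0..len e})
        (\<Union>K\<in>\<K>. {t \<in> {0..len e}. edge_map e t \<in> K})"
        using 4 by (intro openin_Union) auto
      moreover have "(\<Union>K\<in>\<K>. {t \<in> {0..len e}. edge_map e t \<in> K})
        = {t \<in> {0..len e}. edge_map e t \<in> \<Union>\<K>}" by auto
      ultimately show "openin (top_of_set {0..len e}) {t \<in> {0..len e}. edge_map e t \<in> \<Union>\<K>}"
        by simp
    qed
  qed (blast)+
  from topology_inverse'[OF this] show ?thesis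
    unfolding mg_topology_def by (rule fun_cong)
qed

lemma edge_map_in_points:
  assumes "e \<in> arcs G" "t \<in> {0..len e}"
  shows "edge_map e t \<in> points"
  using assms by (auto simp: edge_map_def points_def)

lemma topspace_mg_topology: "topspace mg_topology = points"
proof -
  have "openin mg_topology points"
    unfolding openin_mg_topology
  proof (intro conjI ballI)
    fix e assume "e \<in> arcs G"
    then have "{t \<in> {0..len e}. edge_map e t \<in> points} = {0..len e}"
      using edge_map_in_points by blast
    then show "openin (top_of_set {0..len e}) {t \<in> {0..len e}. edge_map e t \<in> points}"
      by simp
  qed simp
  then have "points \<subseteq> topspace mg_topology" by (rule openin_subset)
  moreover have "topspace mg_topology \<subseteq> points"
    using openin_mg_topology[of "topspace mg_topology"] openin_topspace[of mg_topology] by simp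
  ultimately show ?thesis by simp
qed

definition mg_borel :: "('v, 'e) mg_point measure" where
  "mg_borel = sigma points {U. openin mg_topology U}"

lemma space_mg_borel: "space mg_borel = points"
  unfolding mg_borel_def by (rule space_measure_of) (use openin_mg_topology in blast)

text \<open>Functions on the metric graph are extended by 0 to the whole type of points, so that
  equality and dimensions only take values at actual points into account.\<close>

definition H1 :: "(('v, 'e) mg_point \<Rightarrow> real) set" where
  "H1 = {f. continuous_map mg_topology euclideanreal f \<and> (\<forall>p. p \<notin> points \<longrightarrow> f p = 0) \<and>
     (\<forall>e\<in>arcs G. f \<circ> edge_map e \<in> H1_interval (len e))}"

definition q :: "(('v, 'e) mg_point \<Rightarrow> real) \<Rightarrow> (('v, 'e) mg_point \<Rightarrow> real) \<Rightarrow> real" where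
  "q f g = (\<Sum>e\<in>arcs G. \<integral>t. wderiv (len e) (f \<circ> edge_map e) t * wderiv (len e) (g \<circ> edge_map e) t
     \<partial>lebesgue_on {0<..<len e})"

definition harmonic_on :: "(('v, 'e) mg_point \<Rightarrow> real) \<Rightarrow> ('v, 'e) mg_point set \<Rightarrow> bool" where
  "harmonic_on f U \<longleftrightarrow> f \<in> H1 \<and> (\<forall>g\<in>H1. (\<forall>p\<in>points - U. g p = 0) \<longrightarrow> q f g = 0)"

definition borel_prob_measures :: "('v, 'e) mg_point measure set" where
  "borel_prob_measures = {\<mu>. sets \<mu> = sets mg_borel \<and> prob_space \<mu>}"

definition supp :: "('v, 'e) mg_point measure \<Rightarrow> ('v, 'e) mg_point set" where
  "supp \<mu> = {p \<in> points. \<forall>U. openin mg_topology U \<and> p \<in> U \<longrightarrow> emeasure \<mu> U > 0}"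

definition H1_on :: "('v, 'e) mg_point measure \<Rightarrow> (('v, 'e) mg_point \<Rightarrow> real) set" where
  "H1_on \<mu> = {f \<in> H1. harmonic_on f (points - supp \<mu>)}"

text \<open>\<open>H_rel \<mu> f g\<close> states that \<open>f\<close> lies in the domain of the operator \<open>H\<^sub>\<mu>\<close> and that
  \<open>H\<^sub>\<mu> f = g\<close> in the space of square integrable functions.\<close>

definition H_rel ::
  "('v, 'e) mg_point measure \<Rightarrow> (('v, 'e) mg_point \<Rightarrow> real) \<Rightarrow> (('v, 'e) mg_point \<Rightarrow> real) \<Rightarrow> bool" where
  "H_rel \<mu> f g \<longleftrightarrow> f \<in> H1_on \<mu> \<and> g \<in> L2 \<mu> \<and>
     (\<forall>\<phi>\<in>H1_on \<mu>. q f \<phi> = (\<integral>p. g p * \<phi> p \<partial>\<mu>))"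

definition eigenspace :: "('v, 'e) mg_point measure \<Rightarrow> real \<Rightarrow> (('v, 'e) mg_point \<Rightarrow> real) set" where
  "eigenspace \<mu> r = {f. H_rel \<mu> f (\<lambda>p. r * f p)}"

text \<open>Since functions in \<^term>\<open>H1_on \<mu>\<close> that agree almost everywhere are equal, this is the
  multiplicity of \<open>r\<close> in the space of square integrable functions. The spectrum is discrete, so
  all multiplicities are finite, and so is the index set of the sum in the counting
  function.\<close>

definition eigen_mult :: "('v, 'e) mg_point measure \<Rightarrow> real \<Rightarrow> nat" where
  "eigen_mult \<mu> r = real_fun.dim (eigenspace \<mu> r)"

definition eigenvalue_count :: "('v, 'e) mg_point measure \<Rightarrow> real \<Rightarrow> nat" where
  "eigenvalue_count \<mu> r = (\<Sum>s | s \<le> r \<and> eigen_mult \<mu> s \<noteq> 0. eigen_mult \<mu> s)"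

text \<open>The \<open>k\<close>-th eigenvalue in increasing order, counted with multiplicity and starting from
  \<open>k = 0\<close>.\<close>

definition eigenvalue :: "nat \<Rightarrow> ('v, 'e) mg_point measure \<Rightarrow> ereal" where
  "eigenvalue k \<mu> =
     (if L2_dim \<mu> \<le> enat k then \<infinity> else Inf {ereal r | r. k < eigenvalue_count \<mu> r})"

definition eigenvalue_min :: "nat \<Rightarrow> ereal" where
  "eigenvalue_min k = (INF \<mu>\<in>borel_prob_measures. eigenvalue k \<mu>)"

definition half_dirac_sum ::
  "('v, 'e) mg_point \<Rightarrow> ('v, 'e) mg_point \<Rightarrow> ('v, 'e) mg_point measure" where
  "half_dirac_sum x y = measure_of (space mg_borel) (sets mg_borel)
     (\<lambda>A. 1/2 * emeasure (return mg_borel x) A + 1/2 * emeasure (return mg_borel y) A)"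

lemma sets_half_dirac_sum: "sets (half_dirac_sum x y) = sets mg_borel"
  by (simp add: half_dirac_sum_def)

lemma emeasure_half_dirac_sum:
  assumes "A \<in> sets mg_borel"
  shows "emeasure (half_dirac_sum x y) A = 1/2 * indicator A x + 1/2 * indicator A y"
proof -
  let ?m = "\<lambda>A. 1/2 * emeasure (return mg_borel x) A + 1/2 * emeasure (return mg_borel y) A"
  have "countably_additive (sets mg_borel) ?m"
  proof (rule countably_additiveI)
    fix A :: "nat \<Rightarrow> _" assume A: "range A \<subseteq> sets mg_borel" "disjoint_family A"
    have sum: "(\<Sum>i. emeasure (return mg_borel z) (A i)) = emeasure (return mg_borel z) (\<Union>(range A))"
      for z using A by (intro suminf_emeasure) simp_all
    have "(\<Sum>i. ?m (A i)) = (\<Sum>i. 1/2 * emeasure (return mg_borel x) (A i)) +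
        (\<Sum>i. 1/2 * emeasure (return mg_borel y) (A i))"
      by (rule suminf_add[symmetric]) (rule summableI)+
    then show "(\<Sum>i. ?m (A i)) = ?m (\<Union>(range A))"
      by (simp only: ennreal_suminf_cmult sum)
  qed
  then have "emeasure (half_dirac_sum x y) A = ?m A"
    using assms unfolding half_dirac_sum_def
    by (intro emeasure_measure_of_sigma sets.sigma_algebra_axioms) (simp_all add: positive_def)
  then show ?thesis
    using assms by simp
qed

end

end

theory Submission
  imports Defs
begin

text \<open>
  For points \<open>x\<close>, \<open>y\<close> of the graph let \<open>g\<close> represent \<open>f \<mapsto> f x - f y\<close> on \<open>H\<^sup>1\<close> with respect to
  \<open>q\<close>, and let \<open>R(x, y) = q(g, g) = g x - g y\<close> be the effective resistance, so that
  \<open>(f x - f y)\<^sup>2 \<le> R(x, y) q(f, f)\<close>. An explicit formula for \<open>g\<close> shows that \<open>R\<close> is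
  continuous, hence it attains a maximum \<open>M\<close>. An eigenfunction \<open>f\<close> of a nonzero eigenvalue \<open>s\<close> of
  \<open>H\<^sub>\<mu>\<close> has mean 0, so integrating \<open>(max f - f) (f - min f) \<ge> 0\<close> gives
  \<open>\<integral> f\<^sup>2 d\<mu> \<le> (max f - min f)\<^sup>2 / 4 \<le> M q(f, f) / 4 = M s / 4 \<integral> f\<^sup>2 d\<mu>\<close>, that is \<open>s \<ge> 4 / M\<close>. If equality
  holds, then \<open>\<mu>\<close> is carried by the extremal points of \<open>f\<close>, and \<open>f\<close> is a multiple of the
  representing function of every pair of a maximal and a minimal point; as \<open>H\<^sup>1\<close> separates points, there is
  only one such pair, and the vanishing mean gives the weights. For the two-point measure at a pair
  maximising \<open>R\<close> the eigenvalue \<open>4 / M\<close> is computed directly.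
\<close>

subsection \<open>Test functions\<close>

text \<open>The form \<open>q\<close> is built from weak derivatives picked by a choice operator and
  known only through test functions. The bridge to point values is that the integral of a weak
  derivative over a subinterval is a difference of values of the function; the test functions below
  serve to prove this. The representing function then comes in two layers: between vertices it
  solves a finite linear problem, the weighted graph Laplacian with conductances
  \<open>1 / len e\<close>, and inside an edge the Dirichlet Green function corrects linear
  interpolation. The constant 4 is that of Popoviciu's inequality: a random variable with range of
  length d has variance at most d^2 / 4, with equality only for equal weights at the two ends.
  Eigenfunctions come straight from nonzero multiplicities, and the finiteness of the set of
  eigenvalues up to r is read off a nonzero value of \<open>eigenvalue_count\<close>.\<close>

lemma has_real_derivative_pos_part_square:
  "((\<lambda>x::real. (max 0 x)\<^sup>2) has_real_derivative 2 * max 0 x) (at x)"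
proof (cases x "0 :: real" rule: linorder_cases)
  case less
  have "((\<lambda>x::real. 0) has_real_derivative 2 * max 0 x) (at x)"
    using less by simp
  then show ?thesis
    by (rule has_field_derivative_transform_within_open[where S = "{..<0}"]) (use less in auto)
next
  case equal
  have "((\<lambda>h::real. (max 0 h)\<^sup>2 / h) \<longlongrightarrow> 0) (at 0)"
  proof (rule Lim_null_comparison)
    show "((\<lambda>h::real. \<bar>h\<bar>) \<longlongrightarrow> 0) (at 0)"
      using tendsto_rabs[OF tendsto_ident_at, of "0::real" UNIV] by simp
    show "\<forall>\<^sub>F h in at (0::real). norm ((max 0 h)\<^sup>2 / h) \<le> \<bar>h\<bar>"
      by (rule always_eventually) (auto simp: max_def power2_eq_square)
  qed
  then show ?thesis
    using equal by (simp add: DERIV_def)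
next
  case greater
  have "((\<lambda>x::real. x\<^sup>2) has_real_derivative 2 * max 0 x) (at x)"
    using greater by (auto intro!: derivative_eq_intros)
  then show ?thesis
    by (rule has_field_derivative_transform_within_open[where S = "{0<..}"]) (use greater in auto)
qed

text \<open>A C1 transition from 0 to 1 on [0, 1], glued from two parabolas: the coefficients 1, -2,
  1 of the truncated squares form a second difference, which is constant beyond 1, and the factor 2
  makes this constant 1. The derivative is the hat function of height 2 and area 1.\<close>

definition step :: "real \<Rightarrow> real" where
  "step t = 2 * ((max 0 t)\<^sup>2 - 2 * (max 0 (t - 1/2))\<^sup>2 + (max 0 (t - 1))\<^sup>2)"

definition step' :: "real \<Rightarrow> real" where
  "step' t = 4 * (max 0 t - 2 * max 0 (t - 1/2) + max 0 (t - 1))"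

lemma has_real_derivative_step: "(step has_real_derivative step' t) (at t)"
proof -
  have shift: "((\<lambda>t. (max 0 (t - c))\<^sup>2) has_real_derivative 2 * max 0 (t - c)) (at t)" for c
  proof -
    have "((\<lambda>t. t - c) has_real_derivative 1) (at t)"
      by (auto intro!: derivative_eq_intros)
    from DERIV_chain2[OF has_real_derivative_pos_part_square this] show ?thesis by simp
  qed
  show ?thesis
    using DERIV_cmult[OF DERIV_add[OF DERIV_diff[OF shift[of 0] DERIV_cmult[OF shift[of "1/2"], of 2]] shift[of 1]], of 2]
    unfolding step_def [abs_def] step'_def by (simp add: algebra_simps)
qed

lemma continuous_on_step': "continuous_on S step'"
  unfolding step'_def [abs_def] by (intro continuous_intros)

lemma step_eq_0: "t \<le> 0 \<Longrightarrow> step t = 0"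
  by (simp add: step_def)

lemma step_eq_1: "1 \<le> t \<Longrightarrow> step t = 1"
  by (simp add: step_def power2_eq_square field_simps)

lemma step'_eq_0: "t \<notin> {0..1} \<Longrightarrow> step' t = 0"
  by (auto simp: step'_def)

lemma step'_bounds: "0 \<le> step' t" "step' t \<le> 2"
  by (auto simp: step'_def max_def)

lemma step_bounds: "0 \<le> step t" "step t \<le> 1"
proof -
  have mono: "step s \<le> step t" if "s \<le> t" for s t
    using that has_real_derivative_step step'_bounds(1) by (meson DERIV_nonneg_imp_nondecreasing)
  show "0 \<le> step t" "step t \<le> 1"
    using mono[of "min 0 t" t] mono[of t "max 1 t"] by (simp_all add: step_eq_0 step_eq_1)
qed

lemma integral_step': "(\<integral>t. step' t \<partial>lborel) = 1"
proof -
  have "(\<integral>t. step' t * indicator {0..1} t \<partial>lborel) = step 1 - step 0"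
    by (intro integral_FTC_Icc_real)
       (auto simp: has_real_derivative_step intro: continuous_on_interior[OF continuous_on_step'[of UNIV]])
  moreover have "(\<lambda>t. step' t * indicator {0..1} t) = step'"
    using step'_eq_0 by (fastforce simp: indicator_def)
  ultimately show ?thesis
    by (simp add: step_eq_0 step_eq_1)
qed

text \<open>As \<open>\<epsilon>\<close> tends to 0 these functions approximate the indicator of \<open>{a<..<b}\<close>; their
  supports stay away from \<open>a\<close> and \<open>b\<close>, so that \<open>a = 0\<close> and \<open>b = L\<close> are allowed.\<close>

definition plateau :: "real \<Rightarrow> real \<Rightarrow> real \<Rightarrow> real \<Rightarrow> real" where
  "plateau a b \<epsilon> t = step ((t - a) / \<epsilon> - 1) - step ((t - b) / \<epsilon> + 2)"

lemma has_real_derivative_plateau: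
  assumes "\<epsilon> \<noteq> 0"
  shows "(plateau a b \<epsilon> has_real_derivative (step' ((t - a) / \<epsilon> - 1) - step' ((t - b) / \<epsilon> + 2)) / \<epsilon>) (at t)"
proof -
  have "((\<lambda>t. step ((t - p) / \<epsilon> + c)) has_real_derivative step' ((t - p) / \<epsilon> + c) * (1 / \<epsilon>)) (at t)" for p c
    by (rule DERIV_chain2[OF has_real_derivative_step]) (use assms in \<open>auto intro!: derivative_eq_intros\<close>)
  from DERIV_diff[OF this[of a "-1"] this[of b 2]] show ?thesis
    by (simp add: plateau_def [abs_def] diff_divide_distrib)
qed

lemma plateau_eq_0:
  assumes "0 < \<epsilon>" "a + 4 * \<epsilon> \<le> b" "t \<notin> {a + \<epsilon>..b - \<epsilon>}"
  shows "plateau a b \<epsilon> t = 0"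
proof (cases "t < a + \<epsilon>")
  case True
  then have "(t - a) / \<epsilon> - 1 \<le> 0" "(t - b) / \<epsilon> + 2 \<le> 0"
    using assms by (auto simp: field_simps)
  then show ?thesis
    by (simp add: plateau_def step_eq_0)
next
  case False
  then have "1 \<le> (t - a) / \<epsilon> - 1" "1 \<le> (t - b) / \<epsilon> + 2"
    using assms by (auto simp: field_simps)
  then show ?thesis
    by (simp add: plateau_def step_eq_1)
qed

lemma plateau_eq_1:
  assumes "0 < \<epsilon>" "a + 2 * \<epsilon> \<le> t" "t \<le> b - 2 * \<epsilon>"
  shows "plateau a b \<epsilon> t = 1"
proof -
  have "1 \<le> (t - a) / \<epsilon> - 1" "(t - b) / \<epsilon> + 2 \<le> 0"
    using assms by (auto simp: field_simps)
  then show ?thesis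
    by (simp add: plateau_def step_eq_1 step_eq_0)
qed

lemma plateau_abs_le_1: "\<bar>plateau a b \<epsilon> t\<bar> \<le> 1"
  using step_bounds[of "(t - a) / \<epsilon> - 1"] step_bounds[of "(t - b) / \<epsilon> + 2"]
  by (simp add: plateau_def)

lemma C1_compact_support_plateau:
  assumes "0 \<le> a" "b \<le> L" "0 < \<epsilon>" "a + 4 * \<epsilon> \<le> b"
  shows "C1_compact_support L (plateau a b \<epsilon>)"
  unfolding C1_compact_support_def C1_differentiable_on_def
proof (intro conjI exI ballI allI impI)
  fix t
  show "(plateau a b \<epsilon> has_vector_derivative (step' ((t - a) / \<epsilon> - 1) - step' ((t - b) / \<epsilon> + 2)) / \<epsilon>) (at t)"
    using has_real_derivative_plateau assms(3) by (simp add: has_real_derivative_iff_has_vector_derivative)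
next
  show "continuous_on UNIV (\<lambda>t. (step' ((t - a) / \<epsilon> - 1) - step' ((t - b) / \<epsilon> + 2)) / \<epsilon>)"
    using assms by (intro continuous_intros continuous_on_compose2[OF continuous_on_step'[of UNIV]]) auto
next
  show "0 < a + \<epsilon>" "b - \<epsilon> < L" using assms by auto
  show "plateau a b \<epsilon> t = 0" if "t \<notin> {a + \<epsilon>..b - \<epsilon>}" for t
    using plateau_eq_0[OF assms(3,4) that] .
qed

text \<open>As \<open>step'\<close> is supported in [0, 1] with integral 1, the kernels are
  approximate identities at \<open>a\<close>. The substitution t = a + \<epsilon> (s - c) frees the
  kernel from n, and dominated convergence applies. The offset \<open>c\<close> is -1 for the left
  flank of a plateau and 2 for the right one.\<close>

lemma mollified_tendsto:
  fixes w :: "real \<Rightarrow> real"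
  assumes w: "continuous_on UNIV w" "\<And>t. \<bar>w t\<bar> \<le> B"
    and \<epsilon>: "\<epsilon> \<longlonglongrightarrow> 0" "\<And>n. 0 < \<epsilon> n"
  shows "(\<lambda>n. \<integral>t. w t * step' ((t - a) / \<epsilon> n + c) / \<epsilon> n \<partial>lborel) \<longlonglongrightarrow> w a"
proof -
  have [measurable]: "w \<in> borel_measurable borel" "step' \<in> borel_measurable borel"
    using w(1) continuous_on_step' by (auto intro: borel_measurable_continuous_onI)
  have subst: "(\<integral>t. w t * step' ((t - a) / \<epsilon> n + c) / \<epsilon> n \<partial>lborel)
      = (\<integral>s. w (a + \<epsilon> n * (s - c)) * step' s \<partial>lborel)" for n
  proof -
    have "(\<integral>t. w t * step' ((t - a) / \<epsilon> n + c) / \<epsilon> n \<partial>lborel)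
        = \<bar>\<epsilon> n\<bar> *\<^sub>R (\<integral>s. w (a - \<epsilon> n * c + \<epsilon> n * s) * step' ((a - \<epsilon> n * c + \<epsilon> n * s - a) / \<epsilon> n + c) / \<epsilon> n \<partial>lborel)"
      using \<epsilon>(2)[of n] by (intro lborel_integral_real_affine[where c = "\<epsilon> n" and t = "a - \<epsilon> n * c"]) simp
    also have "\<dots> = (\<integral>s. \<epsilon> n * (w (a - \<epsilon> n * c + \<epsilon> n * s) * step' ((a - \<epsilon> n * c + \<epsilon> n * s - a) / \<epsilon> n + c) / \<epsilon> n) \<partial>lborel)"
      using \<epsilon>(2)[of n] by simp
    also have "\<dots> = (\<integral>s. w (a + \<epsilon> n * (s - c)) * step' s \<partial>lborel)"
      using \<epsilon>(2)[of n] by (intro Bochner_Integration.integral_cong) (auto simp: algebra_simps diff_divide_distrib add_divide_distrib)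
    finally show ?thesis .
  qed
  have "(\<lambda>n. \<integral>s. w (a + \<epsilon> n * (s - c)) * step' s \<partial>lborel) \<longlonglongrightarrow> (\<integral>s. w a * step' s \<partial>lborel)"
  proof (rule integral_dominated_convergence[where w = "\<lambda>s. 2 * B * indicator {0..1} s"])
    show "AE s in lborel. (\<lambda>n. w (a + \<epsilon> n * (s - c)) * step' s) \<longlonglongrightarrow> w a * step' s"
    proof (rule AE_I2)
      fix s
      have "(\<lambda>n. a + \<epsilon> n * (s - c)) \<longlonglongrightarrow> a + 0 * (s - c)"
        by (intro tendsto_intros \<epsilon>)
      then have "(\<lambda>n. w (a + \<epsilon> n * (s - c))) \<longlonglongrightarrow> w a"
        using continuous_on_tendsto_compose[OF w(1)] by simp
      then show "(\<lambda>n. w (a + \<epsilon> n * (s - c)) * step' s) \<longlonglongrightarrow> w a * step' s"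
        by (intro tendsto_intros)
    qed
    have "\<bar>w t * step' s\<bar> \<le> 2 * B * indicator {0..1} s" for t s
    proof (cases "s \<in> {0..1}")
      case True
      have "\<bar>w t\<bar> * \<bar>step' s\<bar> \<le> B * 2"
        using w(2)[of t] step'_bounds[of s] by (intro mult_mono) auto
      then show ?thesis using True by (simp add: abs_mult)
    qed (simp add: step'_eq_0)
    then show "AE s in lborel. norm (w (a + \<epsilon> n * (s - c)) * step' s) \<le> 2 * B * indicator {0..1} s" for n
      by simp
  qed auto
  then show ?thesis
    unfolding subst using integral_step' by simp
qed

subsection \<open>Square integrable functions\<close>

lemma L2_mult_integrable:
  assumes "f \<in> L2 M" "g \<in> L2 M"
  shows "integrable M (\<lambda>x. f x * g x)"
proof (rule Bochner_Integration.integrable_bound)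
  show "integrable M (\<lambda>x. ((f x)\<^sup>2 + (g x)\<^sup>2) / 2)"
    using assms by (auto simp: L2_def)
  show "(\<lambda>x. f x * g x) \<in> borel_measurable M"
    using assms by (auto simp: L2_def)
  have "\<bar>f x * g x\<bar> \<le> ((f x)\<^sup>2 + (g x)\<^sup>2) / 2" for x
    using sum_squares_bound[of "\<bar>f x\<bar>" "\<bar>g x\<bar>"] by (simp add: abs_mult)
  then show "AE x in M. norm (f x * g x) \<le> norm (((f x)\<^sup>2 + (g x)\<^sup>2) / 2)"
    by simp
qed

text \<open>Linearity is stated in the form f + c g here and below; sums, differences and multiples
  are instances, the multiple c f being f + (c - 1) f.\<close>

lemma L2_add_cmult:
  assumes "f \<in> L2 M" "g \<in> L2 M"
  shows "(\<lambda>x. f x + c * g x) \<in> L2 M"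
proof -
  have "integrable M (\<lambda>x. (f x)\<^sup>2 + 2 * c * (f x * g x) + c\<^sup>2 * (g x)\<^sup>2)"
    using assms L2_mult_integrable[OF assms] by (auto simp: L2_def)
  then have "integrable M (\<lambda>x. (f x + c * g x)\<^sup>2)"
    by (simp add: power2_eq_square algebra_simps)
  then show ?thesis
    using assms by (auto simp: L2_def)
qed

lemma (in finite_measure) L2_bounded:
  assumes "f \<in> borel_measurable M" "\<And>x. x \<in> space M \<Longrightarrow> \<bar>f x\<bar> \<le> B"
  shows "f \<in> L2 M"
proof -
  have "integrable M (\<lambda>x. (f x)\<^sup>2)"
  proof (rule integrable_const_bound)
    show "AE x in M. norm ((f x)\<^sup>2) \<le> B\<^sup>2"
      using assms(2) by (intro AE_I2) (simp add: abs_le_square_iff[symmetric] order_trans[OF _ abs_ge_self])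
  qed (use assms in auto)
  then show ?thesis using assms by (simp add: L2_def)
qed

lemma (in finite_measure) L2_integrable:
  assumes "f \<in> L2 M"
  shows "integrable M f"
  using L2_mult_integrable[OF assms L2_bounded[of "\<lambda>_. 1" 1]] by simp

subsection \<open>Weak derivatives on an interval\<close>

lemma finite_measure_interval: "finite_measure (lebesgue_on {0<..<L::real})"
  by (rule finite_measure_lebesgue_on) simp

lemma integral_interval_eq_lborel:
  fixes f :: "real \<Rightarrow> real"
  assumes "f \<in> borel_measurable borel" "\<And>t. t \<notin> {0<..<L} \<Longrightarrow> f t = 0"
  shows "(\<integral>t. f t \<partial>lebesgue_on {0<..<L}) = (\<integral>t. f t \<partial>lborel)"
proof -
  have "(\<integral>t. f t \<partial>lebesgue_on {0<..<L}) = (\<integral>t. indicator {0<..<L} t *\<^sub>R f t \<partial>lebesgue)"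
    by (rule integral_restrict_space) simp
  also have "(\<lambda>t. indicator {0<..<L} t *\<^sub>R f t) = f"
    using assms(2) by (force simp: fun_eq_iff indicator_def)
  finally show ?thesis
    using assms(1) by (simp add: integral_completion)
qed

text \<open>The fundamental theorem of calculus for weak derivatives. Tested with plateaus, whose
  derivatives act on \<open>u\<close> as an approximate identity at \<open>a\<close> minus one at
  \<open>b\<close>, while the plateaus themselves converge boundedly to the indicator of the
  interval.\<close>

theorem weak_derivative_integral:
  assumes wd: "weak_derivative L u g" and u: "continuous_on {0..L} u"
    and ab: "0 \<le> a" "a \<le> b" "b \<le> L"
  shows "(\<integral>t. g t * indicator {a<..<b} t \<partial>lebesgue_on {0<..<L}) = u b - u a"
proof (cases "a = b")
  case False
  then have "a < b" "0 < L" using ab by auto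
  \<comment> \<open>The factor 1/4 gives \<open>a + 4 * \<epsilon> n \<le> b\<close> for every n, so
    that each plateau has room for both flanks.\<close>
  define \<epsilon> where "\<epsilon> n = (b - a) / 4 * (1 / real (Suc n))" for n
  \<comment> \<open>The constant continuation beyond [0, L] is bounded and continuous on the line,
    where the approximate identities are stated.\<close>
  define w where "w t = u (max 0 (min L t))" for t
  interpret finite_measure "lebesgue_on {0<..<L}" by (rule finite_measure_interval)
  have \<epsilon>_pos: "0 < \<epsilon> n" for n using \<open>a < b\<close> by (simp add: \<epsilon>_def)
  have \<epsilon>_le: "a + 4 * \<epsilon> n \<le> b" for n
  proof -
    have "4 * ((b - a) / 4 * r) \<le> b - a" if "r \<le> 1" for r
      using mult_left_mono[OF that, of "b - a"] \<open>a < b\<close> by simp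
    from this[of "1 / real (Suc n)"] have "4 * \<epsilon> n \<le> b - a"
      unfolding \<epsilon>_def by simp
    then show ?thesis by simp
  qed
  have "(\<lambda>n. (b - a) / 4 * (1 / real (Suc n))) \<longlonglongrightarrow> (b - a) / 4 * 0"
    by (intro tendsto_mult_left LIMSEQ_Suc[OF lim_1_over_n])
  then have \<epsilon>_lim: "\<epsilon> \<longlonglongrightarrow> 0"
    by (simp only: \<epsilon>_def [abs_def] mult_zero_right)
  have w_cont: "continuous_on UNIV w"
    unfolding w_def using \<open>0 < L\<close>
    by (intro continuous_on_compose2[OF u]) (auto intro!: continuous_intros)
  have "compact (u ` {0..L})"
    using u by (intro compact_continuous_image) auto
  then obtain B where B: "\<And>t. t \<in> {0..L} \<Longrightarrow> \<bar>u t\<bar> \<le> B"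
    using compact_imp_bounded by (force simp: bounded_iff)
  have w_bound: "\<bar>w t\<bar> \<le> B" for t
    unfolding w_def using \<open>0 < L\<close> by (intro B) auto
  have [measurable]: "w \<in> borel_measurable borel" "step' \<in> borel_measurable borel"
    using w_cont continuous_on_step' by (auto intro: borel_measurable_continuous_onI)
  have deriv: "deriv (plateau a b (\<epsilon> n)) t
      = (step' ((t - a) / \<epsilon> n - 1) - step' ((t - b) / \<epsilon> n + 2)) / \<epsilon> n" for n t
    by (rule DERIV_imp_deriv) (use \<epsilon>_pos[of n] in \<open>auto intro: has_real_derivative_plateau\<close>)
  have deriv_0: "deriv (plateau a b (\<epsilon> n)) t = 0" if "t \<notin> {0<..<L}" for n t
  proof (rule DERIV_imp_deriv, rule has_field_derivative_transform_within_open)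
    show "((\<lambda>t. 0) has_real_derivative 0) (at t)" by simp
    show "open (- {a + \<epsilon> n..b - \<epsilon> n})" by (simp add: open_Compl)
    show "t \<in> - {a + \<epsilon> n..b - \<epsilon> n}" using that ab \<epsilon>_pos[of n] by auto
    show "0 = plateau a b (\<epsilon> n) s" if "s \<in> - {a + \<epsilon> n..b - \<epsilon> n}" for s
      using plateau_eq_0[OF \<epsilon>_pos \<epsilon>_le] that by auto
  qed
  have bump_integrable: "integrable lborel (\<lambda>t. w t * step' ((t - p) / \<epsilon> n + c) / \<epsilon> n)" for p c n
  proof -
    have "integrable lborel (\<lambda>t. indicator {p - \<epsilon> n * c..p + \<epsilon> n * (1 - c)} t *\<^sub>R (w t * step' ((t - p) / \<epsilon> n + c) / \<epsilon> n))"
      by (intro borel_integrable_compact continuous_intros continuous_on_compose2[OF continuous_on_step'[of UNIV]]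
          continuous_on_subset[OF w_cont]) (use \<epsilon>_pos[of n] in auto)
    also have "(\<lambda>t. indicator {p - \<epsilon> n * c..p + \<epsilon> n * (1 - c)} t *\<^sub>R (w t * step' ((t - p) / \<epsilon> n + c) / \<epsilon> n))
        = (\<lambda>t. w t * step' ((t - p) / \<epsilon> n + c) / \<epsilon> n)"
    proof
      fix t
      have "step' ((t - p) / \<epsilon> n + c) = 0" if "t \<notin> {p - \<epsilon> n * c..p + \<epsilon> n * (1 - c)}"
        using that \<epsilon>_pos[of n] by (intro step'_eq_0) (auto simp: field_simps)
      then show "indicator {p - \<epsilon> n * c..p + \<epsilon> n * (1 - c)} t *\<^sub>R (w t * step' ((t - p) / \<epsilon> n + c) / \<epsilon> n)
        = w t * step' ((t - p) / \<epsilon> n + c) / \<epsilon> n"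
        by (auto simp: indicator_def)
    qed
    finally show ?thesis .
  qed
  have "(\<integral>t. u t * deriv (plateau a b (\<epsilon> n)) t \<partial>lebesgue_on {0<..<L})
      = (\<integral>t. w t * step' ((t - a) / \<epsilon> n + (-1)) / \<epsilon> n \<partial>lborel)
        - (\<integral>t. w t * step' ((t - b) / \<epsilon> n + 2) / \<epsilon> n \<partial>lborel)" for n
  proof -
    have "(\<integral>t. u t * deriv (plateau a b (\<epsilon> n)) t \<partial>lebesgue_on {0<..<L})
        = (\<integral>t. w t * deriv (plateau a b (\<epsilon> n)) t \<partial>lebesgue_on {0<..<L})"
      by (intro Bochner_Integration.integral_cong) (auto simp: w_def)
    also have "\<dots> = (\<integral>t. w t * deriv (plateau a b (\<epsilon> n)) t \<partial>lborel)"
      using deriv_0 by (intro integral_interval_eq_lborel) (auto simp: deriv)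
    also have "\<dots> = (\<integral>t. w t * step' ((t - a) / \<epsilon> n + (-1)) / \<epsilon> n - w t * step' ((t - b) / \<epsilon> n + 2) / \<epsilon> n \<partial>lborel)"
      by (simp add: deriv algebra_simps diff_divide_distrib)
    finally show ?thesis
      using bump_integrable by (subst Bochner_Integration.integral_diff[symmetric])
  qed
  moreover have "(\<lambda>n. (\<integral>t. w t * step' ((t - a) / \<epsilon> n + (-1)) / \<epsilon> n \<partial>lborel)
        - (\<integral>t. w t * step' ((t - b) / \<epsilon> n + 2) / \<epsilon> n \<partial>lborel)) \<longlonglongrightarrow> w a - w b"
    by (intro tendsto_diff mollified_tendsto[OF w_cont w_bound \<epsilon>_lim \<epsilon>_pos])
  ultimately have left: "(\<lambda>n. \<integral>t. u t * deriv (plateau a b (\<epsilon> n)) t \<partial>lebesgue_on {0<..<L}) \<longlonglongrightarrow> u a - u b"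
    using ab by (simp add: w_def)
  have g: "g \<in> L2 (lebesgue_on {0<..<L})"
    using wd by (simp add: weak_derivative_def)
  then have g_int: "integrable (lebesgue_on {0<..<L}) g" by (rule L2_integrable)
  have plateau_meas: "plateau a b (\<epsilon> n) \<in> borel_measurable (lebesgue_on {0<..<L})" for n
    by (intro continuous_imp_measurable_on_sets_lebesgue DERIV_continuous_on[where D = "\<lambda>t. (step' ((t - a) / \<epsilon> n - 1) - step' ((t - b) / \<epsilon> n + 2)) / \<epsilon> n"])
       (use \<epsilon>_pos[of n] in \<open>auto intro!: has_field_derivative_at_within[OF has_real_derivative_plateau]\<close>)
  have "(\<lambda>n. \<integral>t. g t * plateau a b (\<epsilon> n) t \<partial>lebesgue_on {0<..<L})
      \<longlonglongrightarrow> (\<integral>t. g t * indicator {a<..<b} t \<partial>lebesgue_on {0<..<L})"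
  proof (rule integral_dominated_convergence[where w = "\<lambda>t. \<bar>g t\<bar>"])
    show "AE t in lebesgue_on {0<..<L}. norm (g t * plateau a b (\<epsilon> n) t) \<le> \<bar>g t\<bar>" for n
      using plateau_abs_le_1 by (intro AE_I2) (simp add: abs_mult mult_left_le)
    show "AE t in lebesgue_on {0<..<L}. (\<lambda>n. g t * plateau a b (\<epsilon> n) t) \<longlonglongrightarrow> g t * indicator {a<..<b} t"
    proof (intro AE_I2 tendsto_intros)
      fix t
      show "(\<lambda>n. plateau a b (\<epsilon> n) t) \<longlonglongrightarrow> indicator {a<..<b} t"
      proof (cases "t \<in> {a<..<b}")
        case True
        then have "0 < min (t - a) (b - t) / 2" by auto
        with \<epsilon>_lim have "\<forall>\<^sub>F n in sequentially. \<epsilon> n < min (t - a) (b - t) / 2"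
          by (rule order_tendstoD)
        then have "\<forall>\<^sub>F n in sequentially. plateau a b (\<epsilon> n) t = indicator {a<..<b} t"
          by eventually_elim (use \<epsilon>_pos True in \<open>auto intro!: plateau_eq_1\<close>)
        then show ?thesis by (rule tendsto_eventually)
      next
        case False
        then have "plateau a b (\<epsilon> n) t = 0" for n
          using \<epsilon>_pos[of n] by (intro plateau_eq_0[OF \<epsilon>_pos \<epsilon>_le]) auto
        then show ?thesis using False by simp
      qed
    qed
    show "(\<lambda>t. g t * indicator {a<..<b} t) \<in> borel_measurable (lebesgue_on {0<..<L})"
    proof (intro borel_measurable_times borel_measurable_indicator)
      show "{a<..<b} \<in> sets (lebesgue_on {0<..<L})"
        using ab by (auto simp: sets_restrict_space_iff)
    qed (use g_int in auto)
    show "(\<lambda>t. g t * plateau a b (\<epsilon> n) t) \<in> borel_measurable (lebesgue_on {0<..<L})" for n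
      using g_int plateau_meas by (intro borel_measurable_times) auto
    show "integrable (lebesgue_on {0<..<L}) (\<lambda>t. \<bar>g t\<bar>)" using g_int by simp
  qed
  moreover have "(\<integral>t. u t * deriv (plateau a b (\<epsilon> n)) t \<partial>lebesgue_on {0<..<L})
      = - (\<integral>t. g t * plateau a b (\<epsilon> n) t \<partial>lebesgue_on {0<..<L})" for n
    using wd C1_compact_support_plateau[OF ab(1,3) \<epsilon>_pos \<epsilon>_le] by (simp add: weak_derivative_def)
  ultimately have "(\<lambda>n. \<integral>t. u t * deriv (plateau a b (\<epsilon> n)) t \<partial>lebesgue_on {0<..<L})
      \<longlonglongrightarrow> - (\<integral>t. g t * indicator {a<..<b} t \<partial>lebesgue_on {0<..<L})"
    by (simp add: tendsto_minus)
  with left show ?thesis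
    using LIMSEQ_unique by fastforce
qed simp

text \<open>Intervals generate the Borel sets, so the vanishing of the integrals spreads to all
  Borel sets by induction on how these are built.\<close>

lemma AE_eq_0_if_interval_integrals_eq_0:
  fixes h :: "real \<Rightarrow> real"
  assumes h: "integrable (lebesgue_on {0<..<L}) h"
    and zero: "\<And>a b. 0 \<le> a \<Longrightarrow> a \<le> b \<Longrightarrow> b \<le> L \<Longrightarrow>
      (\<integral>t. h t * indicator {a<..<b} t \<partial>lebesgue_on {0<..<L}) = 0"
  shows "AE t in lebesgue_on {0<..<L}. h t = 0"
proof -
  have h0: "integrable lebesgue (\<lambda>t. indicator {0<..<L} t * h t)"
    using h integrable_restrict_space[of "{0<..<L}" lebesgue h] by simp
  \<comment> \<open>The induction covers Borel sets under \<open>lborel\<close>, but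
    \<open>h\<close> is only Lebesgue measurable; a Borel representative of its extension by 0 takes
    its place.\<close>
  then obtain h' where h' [measurable]: "h' \<in> borel_measurable lborel"
    and "AE t in lborel. indicator {0<..<L} t * h t = h' t"
    using completion_ex_borel_measurable_real[OF borel_measurable_integrable] by blast
  then have ae: "AE t in lebesgue. indicator {0<..<L} t * h t = h' t"
    by (intro AE_completion)
  have "integrable lebesgue h'"
    using h0 by (rule integrable_cong_AE_imp) (use ae in \<open>auto intro: measurable_completion\<close>)
  then have h'_int: "integrable lborel h'"
    by (simp add: integrable_completion)
  have set_int: "set_integrable lborel A h'" if "A \<in> sets borel" for A
    unfolding set_integrable_def using h'_int that by (intro integrable_mult_indicator) simp_all
  have "(LINT t:A|lborel. h' t) = 0" if "A \<in> sets borel" for A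
    using that
  proof (induction rule: borel_set_induct)
    case empty
    then show ?case by (simp add: set_lebesgue_integral_def)
  next
    case (interval a b)
    have "(LINT t:{a..b}|lborel. h' t) = (\<integral>t. h' t * indicator {a<..<b} t \<partial>lborel)"
      unfolding set_lebesgue_integral_def
    proof (rule integral_cong_AE)
      show "AE t in lborel. indicator {a..b} t *\<^sub>R h' t = h' t * indicator {a<..<b} t"
        using AE_lborel_singleton[of a] AE_lborel_singleton[of b]
        by eventually_elim (auto simp: indicator_def)
    qed auto
    also have "\<dots> = (\<integral>t. h' t * indicator {a<..<b} t \<partial>lebesgue)"
      by (simp add: integral_completion)
    also have "\<dots> = (\<integral>t. indicator {0<..<L} t * h t * indicator {a<..<b} t \<partial>lebesgue)"
    proof (rule integral_cong_AE)
      show "(\<lambda>t. h' t * indicator {a<..<b} t) \<in> borel_measurable lebesgue"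
        by (intro measurable_completion) measurable
      show "(\<lambda>t. indicator {0<..<L} t * h t * indicator {a<..<b} t) \<in> borel_measurable lebesgue"
        by (intro borel_measurable_times[OF borel_measurable_integrable[OF h0]] borel_measurable_indicator) simp
      show "AE t in lebesgue. h' t * indicator {a<..<b} t = indicator {0<..<L} t * h t * indicator {a<..<b} t"
        using ae by eventually_elim simp
    qed
    also have "\<dots> = (\<integral>t. h t * indicator {a<..<b} t \<partial>lebesgue_on {0<..<L})"
      by (subst integral_restrict_space) (auto simp: ac_simps)
    \<comment> \<open>The induction delivers arbitrary intervals and the hypothesis covers those
      inside [0, L]: an interval either misses (0, L) or is cut down to it.\<close>
    also have "\<dots> = 0"
    proof (cases "b \<le> 0 \<or> L \<le> a")
      case True
      then have "(\<integral>t. h t * indicator {a<..<b} t \<partial>lebesgue_on {0<..<L}) = (\<integral>t. 0 \<partial>lebesgue_on {0<..<L})"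
        by (intro Bochner_Integration.integral_cong) (auto simp: indicator_def)
      then show ?thesis by simp
    next
      case False
      show ?thesis
      proof (cases "0 < L")
        case True
        have "(\<integral>t. h t * indicator {a<..<b} t \<partial>lebesgue_on {0<..<L})
            = (\<integral>t. h t * indicator {max 0 a<..<min L b} t \<partial>lebesgue_on {0<..<L})"
          by (intro Bochner_Integration.integral_cong) (auto simp: indicator_def)
        also have "\<dots> = 0"
          using False True interval by (intro zero) auto
        finally show ?thesis .
      qed auto
    qed
    finally show ?case .
  next
    case (compl A)
    have "(LINT t:A \<union> - A|lborel. h' t) = (LINT t:A|lborel. h' t) + (LINT t:- A|lborel. h' t)"
      using compl.hyps by (intro set_integral_Un set_int) auto
    moreover have "(LINT t:A \<union> - A|lborel. h' t) = (LINT t:UNIV|lborel. h' t)" by simp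
    moreover have "(LINT t:UNIV|lborel. h' t) = 0"
    proof -
      have "(LINT t:UNIV|lborel. h' t) = (\<integral>t. h' t \<partial>lebesgue)"
        by (simp add: set_lebesgue_integral_def integral_completion)
      also have "\<dots> = (\<integral>t. indicator {0<..<L} t * h t \<partial>lebesgue)"
        by (rule integral_cong_AE) (use ae h0 in \<open>auto intro: measurable_completion\<close>)
      also have "\<dots> = (\<integral>t. h t \<partial>lebesgue_on {0<..<L})"
        by (subst integral_restrict_space) auto
      also have "\<dots> = (\<integral>t. h t * indicator {0<..<L} t \<partial>lebesgue_on {0<..<L})"
        by (intro Bochner_Integration.integral_cong) auto
      also have "\<dots> = 0"
        using zero[of 0 L] by (cases "0 \<le> L") auto
      finally show ?thesis .
    qed
    ultimately show ?case using compl.IH by simp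
  next
    case (union A)
    have "(\<lambda>n. LINT t:(\<Union>i<n. A i)|lborel. h' t) \<longlonglongrightarrow> (LINT t:(\<Union>n. \<Union>i<n. A i)|lborel. h' t)"
    proof (intro set_integral_cont_up set_int)
      show "incseq (\<lambda>n. \<Union>i<n. A i)"
        by (intro monoI UN_mono) auto
    qed (use union.hyps in auto)
    moreover have "(\<Union>n. \<Union>i<n. A i) = (\<Union>i. A i)" by blast
    moreover have "(LINT t:(\<Union>i<n. A i)|lborel. h' t) = 0" for n
      using union.hyps union.IH
      by (subst set_integral_finite_Union) (auto intro: set_int disjoint_family_on_mono)
    ultimately show ?case
      using LIMSEQ_unique[OF _ tendsto_const] by simp
  qed
  then have "AE t in lborel. h' t = 0"
    by (intro density_unique_real[OF h'_int]) (auto simp: set_lebesgue_integral_def)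
  then have "AE t in lebesgue. h' t = 0" by (rule AE_completion)
  with ae have "AE t in lebesgue. t \<in> {0<..<L} \<longrightarrow> h t = 0"
    by eventually_elim (auto simp: indicator_def split: if_splits)
  then show ?thesis by (subst AE_restrict_space_iff) auto
qed

lemma continuous_on_L2:
  fixes f :: "real \<Rightarrow> real"
  assumes "continuous_on {0..L} f"
  shows "f \<in> L2 (lebesgue_on {0<..<L})"
proof -
  interpret finite_measure "lebesgue_on {0<..<L}" by (rule finite_measure_interval)
  have "compact (f ` {0..L})"
    using assms by (intro compact_continuous_image) auto
  then obtain B where B: "\<And>t. t \<in> {0..L} \<Longrightarrow> \<bar>f t\<bar> \<le> B"
    using compact_imp_bounded by (force simp: bounded_iff)
  have "continuous_on {0<..<L} f"
    using assms by (rule continuous_on_subset) auto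
  then show ?thesis
    by (intro L2_bounded[of f B] continuous_imp_measurable_on_sets_lebesgue) (use B in auto)
qed

lemma C1_compact_supportE:
  assumes "C1_compact_support L \<phi>"
  obtains "\<And>t. (\<phi> has_real_derivative deriv \<phi> t) (at t)" "continuous_on UNIV (deriv \<phi>)"
    "\<phi> \<in> L2 (lebesgue_on {0<..<L})" "deriv \<phi> \<in> L2 (lebesgue_on {0<..<L})" "\<phi> 0 = 0" "\<phi> L = 0"
proof -
  from assms obtain D where D: "\<And>t. (\<phi> has_real_derivative D t) (at t)" "continuous_on UNIV D"
    by (auto simp: C1_compact_support_def C1_differentiable_on_def has_real_derivative_iff_has_vector_derivative)
  then have "deriv \<phi> = D" by (auto intro!: DERIV_imp_deriv)
  moreover have "continuous_on {0..L} \<phi>"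
    using D(1) by (auto intro: DERIV_continuous_on has_field_derivative_at_within)
  moreover from assms have "\<phi> 0 = 0" "\<phi> L = 0"
    by (auto simp: C1_compact_support_def)
  ultimately show ?thesis
    using that D continuous_on_subset[OF D(2)] by (auto intro: continuous_on_L2)
qed

text \<open>The difference is a weak derivative of the zero function, so its integral over every
  subinterval is a difference of two zeros.\<close>

lemma weak_derivative_unique:
  assumes "weak_derivative L u g" "weak_derivative L u g'"
  shows "AE t in lebesgue_on {0<..<L}. g t = g' t"
proof -
  interpret finite_measure "lebesgue_on {0<..<L}" by (rule finite_measure_interval)
  let ?h = "\<lambda>t. g t + (- 1) * g' t"
  have g: "g \<in> L2 (lebesgue_on {0<..<L})" "g' \<in> L2 (lebesgue_on {0<..<L})"
    using assms by (auto simp: weak_derivative_def)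
  then have h: "?h \<in> L2 (lebesgue_on {0<..<L})" by (rule L2_add_cmult)
  have "(\<integral>t. ?h t * \<phi> t \<partial>lebesgue_on {0<..<L}) = 0" if \<phi>: "C1_compact_support L \<phi>" for \<phi>
  proof -
    have L2: "\<phi> \<in> L2 (lebesgue_on {0<..<L})" using \<phi> by (rule C1_compact_supportE)
    have "(\<integral>t. ?h t * \<phi> t \<partial>lebesgue_on {0<..<L}) = (\<integral>t. g t * \<phi> t - g' t * \<phi> t \<partial>lebesgue_on {0<..<L})"
      by (simp add: algebra_simps)
    also have "\<dots> = (\<integral>t. g t * \<phi> t \<partial>lebesgue_on {0<..<L}) - (\<integral>t. g' t * \<phi> t \<partial>lebesgue_on {0<..<L})"
      using g L2 by (intro Bochner_Integration.integral_diff L2_mult_integrable)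
    also have "\<dots> = 0"
      using assms \<phi> by (simp add: weak_derivative_def)
    finally show ?thesis .
  qed
  then have "weak_derivative L (\<lambda>_. 0) ?h"
    using h by (simp add: weak_derivative_def)
  then have "AE t in lebesgue_on {0<..<L}. ?h t = 0"
    using weak_derivative_integral[of L "\<lambda>_. 0" ?h]
    by (intro AE_eq_0_if_interval_integrals_eq_0 L2_integrable[OF h]) auto
  then show ?thesis by simp
qed

lemma weak_derivative_wderiv:
  "u \<in> H1_interval L \<Longrightarrow> weak_derivative L u (wderiv L u)"
  unfolding wderiv_def H1_interval_def using someI_ex[of "weak_derivative L u"] by blast

lemma wderiv_L2:
  "u \<in> H1_interval L \<Longrightarrow> wderiv L u \<in> L2 (lebesgue_on {0<..<L})"
  using weak_derivative_wderiv weak_derivative_def by blast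

text \<open>Because \<open>wderiv\<close> is a choice, an explicit derivative can replace it only
  almost everywhere, which suffices under the integrals in \<open>q\<close>.\<close>

lemma wderiv_AE_eq:
  assumes "weak_derivative L u g"
  shows "AE t in lebesgue_on {0<..<L}. wderiv L u t = g t"
proof -
  have "weak_derivative L u (wderiv L u)"
    unfolding wderiv_def using someI[of "weak_derivative L u" g] assms by blast
  then show ?thesis using assms by (rule weak_derivative_unique)
qed

lemma weak_derivative_add_cmult:
  assumes "weak_derivative L u g" "weak_derivative L v h"
    and "u \<in> L2 (lebesgue_on {0<..<L})" "v \<in> L2 (lebesgue_on {0<..<L})"
  shows "weak_derivative L (\<lambda>t. u t + c * v t) (\<lambda>t. g t + c * h t)"
  unfolding weak_derivative_def
proof (intro conjI allI impI)
  have gh: "g \<in> L2 (lebesgue_on {0<..<L})" "h \<in> L2 (lebesgue_on {0<..<L})"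
    using assms by (auto simp: weak_derivative_def)
  then show "(\<lambda>t. g t + c * h t) \<in> L2 (lebesgue_on {0<..<L})" by (rule L2_add_cmult)
  fix \<phi> assume \<phi>: "C1_compact_support L \<phi>"
  have L2: "\<phi> \<in> L2 (lebesgue_on {0<..<L})" "deriv \<phi> \<in> L2 (lebesgue_on {0<..<L})"
    by (rule C1_compact_supportE[OF \<phi>], assumption)+
  have expand: "(\<integral>t. (p t + c * r t) * \<psi> t \<partial>lebesgue_on {0<..<L})
      = (\<integral>t. p t * \<psi> t \<partial>lebesgue_on {0<..<L}) + c * (\<integral>t. r t * \<psi> t \<partial>lebesgue_on {0<..<L})"
    if "p \<in> L2 (lebesgue_on {0<..<L})" "r \<in> L2 (lebesgue_on {0<..<L})" "\<psi> \<in> L2 (lebesgue_on {0<..<L})" for p r \<psi>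
  proof -
    have "integrable (lebesgue_on {0<..<L}) (\<lambda>t. p t * \<psi> t)" "integrable (lebesgue_on {0<..<L}) (\<lambda>t. r t * \<psi> t)"
      using that by (auto intro: L2_mult_integrable)
    then have "(\<integral>t. p t * \<psi> t + c * (r t * \<psi> t) \<partial>lebesgue_on {0<..<L})
      = (\<integral>t. p t * \<psi> t \<partial>lebesgue_on {0<..<L}) + c * (\<integral>t. r t * \<psi> t \<partial>lebesgue_on {0<..<L})" by simp
    then show ?thesis by (simp add: algebra_simps)
  qed
  show "(\<integral>t. (u t + c * v t) * deriv \<phi> t \<partial>lebesgue_on {0<..<L}) = - (\<integral>t. (g t + c * h t) * \<phi> t \<partial>lebesgue_on {0<..<L})"
    using assms gh L2 \<phi> by (simp add: expand) (simp add: weak_derivative_def)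
qed

text \<open>Finitely many exceptional points are allowed for the sake of functions with a kink. The
  fundamental theorem is applied to \<open>u t * \<phi> t\<close>, whose boundary terms vanish with
  the test function.\<close>

lemma weak_derivative_piecewise:
  assumes L: "0 \<le> L" and u: "continuous_on {0..L} u" and S: "finite S"
    and deriv: "\<And>t. t \<in> {0<..<L} - S \<Longrightarrow> (u has_real_derivative g t) (at t)"
    and g: "g \<in> L2 (lebesgue_on {0<..<L})"
  shows "weak_derivative L u g"
  unfolding weak_derivative_def
proof (intro conjI allI impI g)
  fix \<phi> assume \<phi>: "C1_compact_support L \<phi>"
  note E = C1_compact_supportE[OF \<phi>]
  have D: "(\<phi> has_real_derivative deriv \<phi> t) (at t)" for t by (rule E)
  have L2: "\<phi> \<in> L2 (lebesgue_on {0<..<L})" "deriv \<phi> \<in> L2 (lebesgue_on {0<..<L})" and ends: "\<phi> 0 = 0" "\<phi> L = 0"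
    by (rule E, assumption)+
  have int: "integrable (lebesgue_on {0<..<L}) (\<lambda>t. g t * \<phi> t)" "integrable (lebesgue_on {0<..<L}) (\<lambda>t. u t * deriv \<phi> t)"
    using g L2 continuous_on_L2[OF u] by (auto intro: L2_mult_integrable)
  have "((\<lambda>t. g t * \<phi> t + u t * deriv \<phi> t) has_integral (u L * \<phi> L - u 0 * \<phi> 0)) {0..L}"
  proof (rule fundamental_theorem_of_calculus_interior_strong[OF S L])
    show "continuous_on {0..L} (\<lambda>t. u t * \<phi> t)"
      using u D by (intro continuous_on_mult) (auto intro: DERIV_continuous_on has_field_derivative_at_within)
    fix t assume "t \<in> {0<..<L} - S"
    from DERIV_mult[OF deriv[OF this] D]
    show "((\<lambda>t. u t * \<phi> t) has_vector_derivative (g t * \<phi> t + u t * deriv \<phi> t)) (at t)"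
      by (simp add: has_real_derivative_iff_has_vector_derivative[symmetric] algebra_simps)
  qed
  then have "((\<lambda>t. g t * \<phi> t + u t * deriv \<phi> t) has_integral 0) {0<..<L}"
    using ends by (simp add: has_integral_Icc_iff_Ioo)
  moreover have "((\<lambda>t. g t * \<phi> t + u t * deriv \<phi> t) has_integral
      (\<integral>t. g t * \<phi> t + u t * deriv \<phi> t \<partial>lebesgue_on {0<..<L})) {0<..<L}"
    using int by (intro has_integral_integral_lebesgue_on) auto
  ultimately have "(\<integral>t. g t * \<phi> t + u t * deriv \<phi> t \<partial>lebesgue_on {0<..<L}) = 0"
    using has_integral_unique by blast
  then show "(\<integral>t. u t * deriv \<phi> t \<partial>lebesgue_on {0<..<L}) = - (\<integral>t. g t * \<phi> t \<partial>lebesgue_on {0<..<L})"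
    using int by simp
qed

lemma L2_measurable: "f \<in> L2 M \<Longrightarrow> f \<in> borel_measurable M"
  by (simp add: L2_def)

lemma H1_interval_L2: "u \<in> H1_interval L \<Longrightarrow> u \<in> L2 (lebesgue_on {0<..<L})"
  by (simp add: H1_interval_def)

lemma H1_interval_add_cmult:
  assumes "u \<in> H1_interval L" "v \<in> H1_interval L"
  shows "(\<lambda>t. u t + c * v t) \<in> H1_interval L"
  using L2_add_cmult[of u _ v c] weak_derivative_add_cmult[of L u _ v _ c] assms
  unfolding H1_interval_def by blast

subsection \<open>The energy form of a metric graph\<close>

context metric_graph
begin

section \<open>Connectedness, and points as images of edge parameters\<close>

lemma len_neq_0 [simp]: "e \<in> arcs G \<Longrightarrow> len e \<noteq> 0"
  using len_pos[of e] by simp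

text \<open>Connectedness ignores orientation, so a path may run along an arc either way; hence an
  equivalence rather than an implication is asked of each arc.\<close>

lemma connected_induct:
  assumes "r \<in> verts G" "P r" and arcs: "\<And>e. e \<in> arcs G \<Longrightarrow> P (tail G e) \<longleftrightarrow> P (head G e)"
    and "v \<in> verts G"
  shows "P v"
proof -
  interpret S: pair_wf_digraph "mk_symmetric G" ..
  have "r \<rightarrow>\<^sup>*\<^bsub>with_proj (mk_symmetric G)\<^esub> v"
    using connected_graph assms(1,4) by (auto simp: Digraph_Component.connected_def)
  from this show ?thesis
  proof (induction rule: S.reachable_induct)
    case (step x y)
    then obtain e where "e \<in> arcs G" "(x, y) = (tail G e, head G e) \<or> (x, y) = (head G e, tail G e)"
      by (auto simp: parcs_mk_symmetric)
    with step arcs show ?case by auto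
  qed (rule assms(2))
qed

text \<open>No vertex is isolated: some arc exists, both ends of every arc have the property, and
  connectedness spreads it. This lets every point be written as \<open>edge_map e t\<close>.\<close>

lemma vertex_on_arc:
  assumes "v \<in> verts G"
  shows "\<exists>e\<in>arcs G. v = tail G e \<or> v = head G e"
proof -
  obtain e0 where "e0 \<in> arcs G" using arcs_nonempty by blast
  show ?thesis
  proof (rule connected_induct[where r = "tail G e0" and P = "\<lambda>v. \<exists>e\<in>arcs G. v = tail G e \<or> v = head G e"])
    show "tail G e0 \<in> verts G" "\<exists>e\<in>arcs G. tail G e0 = tail G e \<or> tail G e0 = head G e"
      using \<open>e0 \<in> arcs G\<close> by auto
  qed (rule assms | blast)+
qed

lemma points_edge_map:
  assumes "p \<in> points"
  obtains e t where "e \<in> arcs G" "t \<in> {0..len e}" "p = edge_map e t"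
proof (cases p)
  case (Vertex v)
  with assms have "v \<in> verts G" by (auto simp: points_def)
  then obtain e where "e \<in> arcs G" "v = tail G e \<or> v = head G e"
    using vertex_on_arc by blast
  then show ?thesis
    using that[of e 0] that[of e "len e"] Vertex len_pos[of e] by (auto simp: edge_map_def)
next
  case (Inner e t)
  with assms show ?thesis
    using that[of e t] by (auto simp: points_def edge_map_def)
qed

lemma edge_map_0: "edge_map e 0 = Vertex (tail G e)"
  by (simp add: edge_map_def)

lemma edge_map_len: "e \<in> arcs G \<Longrightarrow> edge_map e (len e) = Vertex (head G e)"
  using len_pos[of e] by (auto simp: edge_map_def)

text \<open>The universal property of the final topology.\<close>

lemma continuous_map_mg_topology:
  fixes f :: "('v, 'e) mg_point \<Rightarrow> real"
  shows "continuous_map mg_topology euclideanreal f \<longleftrightarrow>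
    (\<forall>e\<in>arcs G. continuous_on {0..len e} (f \<circ> edge_map e))"
proof -
  have "{t \<in> {0..len e}. edge_map e t \<in> {p \<in> points. f p \<in> U}} = {0..len e} \<inter> (f \<circ> edge_map e) -` U"
    if "e \<in> arcs G" for e U
    using edge_map_in_points[OF that] by auto
  then have "openin mg_topology {p \<in> points. f p \<in> U} \<longleftrightarrow>
      (\<forall>e\<in>arcs G. openin (top_of_set {0..len e}) ({0..len e} \<inter> (f \<circ> edge_map e) -` U))" for U
    unfolding openin_mg_topology by auto
  then show ?thesis
    unfolding continuous_map_def topspace_mg_topology continuous_openin_preimage_eq by auto
qed

section \<open>The space \<open>H1\<close> and the bilinear form \<open>q\<close>\<close>

lemma H1_iff:
  "f \<in> H1 \<longleftrightarrow> (\<forall>p. p \<notin> points \<longrightarrow> f p = 0) \<and>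
     (\<forall>e\<in>arcs G. continuous_on {0..len e} (f \<circ> edge_map e) \<and> f \<circ> edge_map e \<in> H1_interval (len e))"
  by (auto simp: H1_def continuous_map_mg_topology)

lemma H1_edge:
  assumes "f \<in> H1" "e \<in> arcs G"
  shows "continuous_on {0..len e} (\<lambda>t. f (edge_map e t))" "(\<lambda>t. f (edge_map e t)) \<in> H1_interval (len e)"
  using assms by (simp_all add: H1_iff comp_def)

lemma H1_add_cmult:
  assumes "f \<in> H1" "g \<in> H1"
  shows "(\<lambda>p. f p + c * g p) \<in> H1"
  unfolding H1_iff
proof (intro conjI ballI allI impI)
  show "f p + c * g p = 0" if "p \<notin> points" for p
    using assms that by (simp add: H1_iff)
  fix e assume e: "e \<in> arcs G"
  show "continuous_on {0..len e} ((\<lambda>p. f p + c * g p) \<circ> edge_map e)"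
    unfolding comp_def by (intro continuous_intros H1_edge assms e)
  show "(\<lambda>p. f p + c * g p) \<circ> edge_map e \<in> H1_interval (len e)"
    unfolding comp_def by (intro H1_interval_add_cmult H1_edge assms e)
qed

abbreviation edge_deriv :: "'e \<Rightarrow> (('v, 'e) mg_point \<Rightarrow> real) \<Rightarrow> real \<Rightarrow> real" where
  "edge_deriv e f \<equiv> wderiv (len e) (f \<circ> edge_map e)"

lemma edge_deriv_L2: "f \<in> H1 \<Longrightarrow> e \<in> arcs G \<Longrightarrow> edge_deriv e f \<in> L2 (lebesgue_on {0<..<len e})"
  by (intro wderiv_L2) (simp add: H1_iff)

lemma integral_edge_deriv:
  assumes "f \<in> H1" "e \<in> arcs G" "0 \<le> a" "a \<le> b" "b \<le> len e"
  shows "(\<integral>t. edge_deriv e f t * indicator {a<..<b} t \<partial>lebesgue_on {0<..<len e})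
    = f (edge_map e b) - f (edge_map e a)"
  using weak_derivative_integral[OF weak_derivative_wderiv, of "f \<circ> edge_map e" "len e" a b] assms
  by (simp add: H1_iff)

lemma edge_deriv_add_cmult:
  assumes "f \<in> H1" "g \<in> H1" "e \<in> arcs G"
  shows "AE t in lebesgue_on {0<..<len e}.
    edge_deriv e (\<lambda>p. f p + c * g p) t = edge_deriv e f t + c * edge_deriv e g t"
proof (rule wderiv_AE_eq)
  show "weak_derivative (len e) ((\<lambda>p. f p + c * g p) \<circ> edge_map e)
      (\<lambda>t. edge_deriv e f t + c * edge_deriv e g t)"
    unfolding comp_def
    by (intro weak_derivative_add_cmult weak_derivative_wderiv H1_interval_L2 H1_edge assms)
qed

lemma q_commute: "q f g = q g f"
  unfolding q_def by (simp add: mult.commute)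

lemma q_nonneg: "0 \<le> q f f"
  unfolding q_def by (intro sum_nonneg Bochner_Integration.integral_nonneg) simp

lemma q_add_cmult_left:
  assumes "f \<in> H1" "g \<in> H1" "h \<in> H1"
  shows "q (\<lambda>p. f p + c * g p) h = q f h + c * q g h"
proof -
  have "(\<integral>t. edge_deriv e (\<lambda>p. f p + c * g p) t * edge_deriv e h t \<partial>lebesgue_on {0<..<len e})
      = (\<integral>t. edge_deriv e f t * edge_deriv e h t \<partial>lebesgue_on {0<..<len e})
        + c * (\<integral>t. edge_deriv e g t * edge_deriv e h t \<partial>lebesgue_on {0<..<len e})" if e: "e \<in> arcs G" for e
  proof -
    have L2: "edge_deriv e f \<in> L2 (lebesgue_on {0<..<len e})" "edge_deriv e g \<in> L2 (lebesgue_on {0<..<len e})"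
      "edge_deriv e h \<in> L2 (lebesgue_on {0<..<len e})" "edge_deriv e (\<lambda>p. f p + c * g p) \<in> L2 (lebesgue_on {0<..<len e})"
      using assms e H1_add_cmult by (auto intro: edge_deriv_L2)
    have "(\<integral>t. edge_deriv e (\<lambda>p. f p + c * g p) t * edge_deriv e h t \<partial>lebesgue_on {0<..<len e})
        = (\<integral>t. edge_deriv e f t * edge_deriv e h t + c * (edge_deriv e g t * edge_deriv e h t) \<partial>lebesgue_on {0<..<len e})"
    proof (rule integral_cong_AE)
      show "AE t in lebesgue_on {0<..<len e}. edge_deriv e (\<lambda>p. f p + c * g p) t * edge_deriv e h t
        = edge_deriv e f t * edge_deriv e h t + c * (edge_deriv e g t * edge_deriv e h t)"
        using edge_deriv_add_cmult[OF assms(1,2) e, of c] by eventually_elim (simp add: algebra_simps)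
    qed (use L2 in \<open>auto simp: L2_def\<close>)
    also have "\<dots> = (\<integral>t. edge_deriv e f t * edge_deriv e h t \<partial>lebesgue_on {0<..<len e})
        + c * (\<integral>t. edge_deriv e g t * edge_deriv e h t \<partial>lebesgue_on {0<..<len e})"
      using L2_mult_integrable[OF L2(1,3)] L2_mult_integrable[OF L2(2,3)] by simp
    finally show ?thesis .
  qed
  then show ?thesis
    by (simp add: q_def sum.distrib sum_distrib_left)
qed

lemma q_add_cmult_right:
  assumes "f \<in> H1" "g \<in> H1" "h \<in> H1"
  shows "q h (\<lambda>p. f p + c * g p) = q h f + c * q h g"
  using q_add_cmult_left[OF assms] by (simp add: q_commute)

text \<open>Every edge derivative vanishes almost everywhere, so \<open>f\<close> is constant along
  each edge, and shared vertices carry the value through the connected graph.\<close>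

lemma q_eq_0_imp_constant:
  assumes f: "f \<in> H1" and "q f f = 0" and p: "p \<in> points" "p' \<in> points"
  shows "f p = f p'"
proof -
  have const: "f (edge_map e t) = f (edge_map e 0)" if e: "e \<in> arcs G" and t: "t \<in> {0..len e}" for e t
  proof -
    have L2: "edge_deriv e f \<in> L2 (lebesgue_on {0<..<len e})" using f e by (rule edge_deriv_L2)
    have "(\<integral>t. edge_deriv e f t * edge_deriv e f t \<partial>lebesgue_on {0<..<len e}) = 0"
      using assms(2) e unfolding q_def
      by (subst (asm) sum_nonneg_eq_0_iff) (auto intro!: Bochner_Integration.integral_nonneg)
    then have "AE t in lebesgue_on {0<..<len e}. edge_deriv e f t * edge_deriv e f t = 0"
      by (subst (asm) integral_nonneg_eq_0_iff_AE) (auto intro: L2_mult_integrable[OF L2 L2])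
    then have "(\<integral>s. edge_deriv e f s * indicator {0<..<t} s \<partial>lebesgue_on {0<..<len e}) = 0"
      by (intro integral_eq_zero_AE) auto
    then show ?thesis
      using integral_edge_deriv[OF f e, of 0 t] t by simp
  qed
  obtain e t where et: "e \<in> arcs G" "t \<in> {0..len e}" "p = edge_map e t"
    using p(1) by (rule points_edge_map)
  obtain e' t' where et': "e' \<in> arcs G" "t' \<in> {0..len e'}" "p' = edge_map e' t'"
    using p(2) by (rule points_edge_map)
  have "f (Vertex (tail G e')) = f (Vertex (tail G e))"
  proof (rule connected_induct[where r = "tail G e" and P = "\<lambda>v. f (Vertex v) = f (Vertex (tail G e))"])
    fix d assume d: "d \<in> arcs G"
    show "f (Vertex (tail G d)) = f (Vertex (tail G e)) \<longleftrightarrow> f (Vertex (head G d)) = f (Vertex (tail G e))"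
      using const[OF d, of "len d"] len_pos[OF d] d by (simp add: edge_map_0 edge_map_len)
  qed (use et et' in auto)
  then show ?thesis
    using const[OF et(1,2)] const[OF et'(1,2)] by (simp add: et(3) et'(3) edge_map_0)
qed

subsection \<open>Edgewise defined functions\<close>

text \<open>Vertex values are given separately because a vertex may end several edges; that
  \<open>u\<close> agrees with \<open>a\<close> at the ends is left to the lemmas.\<close>

definition from_edges :: "('v \<Rightarrow> real) \<Rightarrow> ('e \<Rightarrow> real \<Rightarrow> real) \<Rightarrow> ('v, 'e) mg_point \<Rightarrow> real" where
  "from_edges a u p = (if p \<in> points then case p of Vertex v \<Rightarrow> a v | Inner e t \<Rightarrow> u e t else 0)"

lemma from_edges_edge_map:
  assumes "e \<in> arcs G" "t \<in> {0..len e}" "u e 0 = a (tail G e)" "u e (len e) = a (head G e)"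
  shows "from_edges a u (edge_map e t) = u e t"
  using assms edge_map_in_points[OF assms(1,2)] by (auto simp: from_edges_def edge_map_def)

text \<open>The set \<open>S e\<close> collects the kinks on \<open>e\<close>. The second claim
  computes energies with the classical derivative \<open>g\<close> in place of the chosen weak
  one.\<close>

lemma from_edges_H1:
  assumes ends: "\<And>e. e \<in> arcs G \<Longrightarrow> u e 0 = a (tail G e)" "\<And>e. e \<in> arcs G \<Longrightarrow> u e (len e) = a (head G e)"
    and cont: "\<And>e. e \<in> arcs G \<Longrightarrow> continuous_on {0..len e} (u e)"
    and S: "\<And>e. e \<in> arcs G \<Longrightarrow> finite (S e)"
    and deriv: "\<And>e t. e \<in> arcs G \<Longrightarrow> t \<in> {0<..<len e} - S e \<Longrightarrow> (u e has_real_derivative g e t) (at t)"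
    and g: "\<And>e. e \<in> arcs G \<Longrightarrow> g e \<in> L2 (lebesgue_on {0<..<len e})"
  shows "from_edges a u \<in> H1"
    and "f \<in> H1 \<Longrightarrow> q (from_edges a u) f
      = (\<Sum>e\<in>arcs G. \<integral>t. g e t * edge_deriv e f t \<partial>lebesgue_on {0<..<len e})"
proof -
  have eq: "(from_edges a u \<circ> edge_map e) t = u e t" if "e \<in> arcs G" "t \<in> {0..len e}" for e t
    using from_edges_edge_map[OF that, of u a] ends that by simp
  have cont': "continuous_on {0..len e} (from_edges a u \<circ> edge_map e)" if "e \<in> arcs G" for e
    using cont[OF that] eq[OF that] by (subst continuous_on_cong[OF refl]) auto
  have wd: "weak_derivative (len e) (from_edges a u \<circ> edge_map e) (g e)" if e: "e \<in> arcs G" for e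
  proof (rule weak_derivative_piecewise[OF _ cont'[OF e] S[OF e] _ g[OF e]])
    show "0 \<le> len e" using len_pos[OF e] by simp
    fix t assume t: "t \<in> {0<..<len e} - S e"
    show "(from_edges a u \<circ> edge_map e has_real_derivative g e t) (at t)"
    proof (rule has_field_derivative_transform_within_open[OF deriv[OF e t]])
      show "u e s = (from_edges a u \<circ> edge_map e) s" if "s \<in> {0<..<len e}" for s
        using eq[OF e, of s] that by auto
    qed (use t in auto)
  qed
  then show H1: "from_edges a u \<in> H1"
    using cont' by (auto simp: H1_iff from_edges_def H1_interval_def intro: continuous_on_L2)
  assume f: "f \<in> H1"
  show "q (from_edges a u) f = (\<Sum>e\<in>arcs G. \<integral>t. g e t * edge_deriv e f t \<partial>lebesgue_on {0<..<len e})"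
    unfolding q_def
  proof (rule sum.cong[OF refl], rule integral_cong_AE)
    fix e assume e: "e \<in> arcs G"
    show "AE t in lebesgue_on {0<..<len e}. edge_deriv e (from_edges a u) t * edge_deriv e f t = g e t * edge_deriv e f t"
      using wderiv_AE_eq[OF wd[OF e]] by eventually_elim simp
  qed (intro borel_measurable_times L2_measurable edge_deriv_L2 f H1 g; assumption)+
qed

section \<open>Affine extensions and tents\<close>

definition affine_extension :: "('v \<Rightarrow> real) \<Rightarrow> ('v, 'e) mg_point \<Rightarrow> real" where
  "affine_extension a = from_edges a (\<lambda>e t. a (tail G e) + (a (head G e) - a (tail G e)) * (t / len e))"

text \<open>The slope is constant on each edge, so integrating the derivative of \<open>f\<close>
  leaves only vertex values. The energy becomes the form of the weighted graph Laplacian.\<close>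

lemma affine_extension:
  shows affine_extension_H1: "affine_extension a \<in> H1"
    and q_affine_extension: "f \<in> H1 \<Longrightarrow> q (affine_extension a) f
      = (\<Sum>e\<in>arcs G. (a (head G e) - a (tail G e)) * (f (Vertex (head G e)) - f (Vertex (tail G e))) / len e)"
proof -
  let ?u = "\<lambda>e t. a (tail G e) + (a (head G e) - a (tail G e)) * (t / len e)"
  let ?g = "\<lambda>e t. (a (head G e) - a (tail G e)) / len e"
  have L2: "?g e \<in> L2 (lebesgue_on {0<..<len e})" for e
    by (intro continuous_on_L2 continuous_intros)
  note H = from_edges_H1[of ?u a "\<lambda>_. {}" ?g, folded affine_extension_def]
  show H1: "affine_extension a \<in> H1"
    by (rule H) (use len_pos in \<open>auto intro!: continuous_intros derivative_eq_intros L2\<close>)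
  assume f: "f \<in> H1"
  have "q (affine_extension a) f = (\<Sum>e\<in>arcs G. \<integral>t. ?g e t * edge_deriv e f t \<partial>lebesgue_on {0<..<len e})"
    by (rule H) (use len_pos f in \<open>auto intro!: continuous_intros derivative_eq_intros L2\<close>)
  also have "\<dots> = (\<Sum>e\<in>arcs G. (a (head G e) - a (tail G e)) * (f (Vertex (head G e)) - f (Vertex (tail G e))) / len e)"
  proof (rule sum.cong[OF refl])
    fix e assume e: "e \<in> arcs G"
    have "(\<integral>t. edge_deriv e f t \<partial>lebesgue_on {0<..<len e}) = (\<integral>t. edge_deriv e f t * indicator {0<..<len e} t \<partial>lebesgue_on {0<..<len e})"
      by (intro Bochner_Integration.integral_cong) auto
    also have "\<dots> = f (Vertex (head G e)) - f (Vertex (tail G e))"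
      using integral_edge_deriv[OF f e, of 0 "len e"] len_pos[OF e] by (simp add: edge_map_0 edge_map_len e)
    finally show "(\<integral>t. ?g e t * edge_deriv e f t \<partial>lebesgue_on {0<..<len e})
      = (a (head G e) - a (tail G e)) * (f (Vertex (head G e)) - f (Vertex (tail G e))) / len e" by simp
  qed
  finally show "q (affine_extension a) f
      = (\<Sum>e\<in>arcs G. (a (head G e) - a (tail G e)) * (f (Vertex (head G e)) - f (Vertex (tail G e))) / len e)" .
qed

text \<open>The Green function of the edge \<open>e\<close> with Dirichlet conditions at its ends.\<close>

definition tent :: "'e \<Rightarrow> real \<Rightarrow> ('v, 'e) mg_point \<Rightarrow> real" where
  "tent e s = from_edges (\<lambda>_. 0) (\<lambda>e' t. if e' = e then min s t - s * t / len e else 0)"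

lemma tent_edge_map:
  assumes "s \<in> {0..len e}" "e' \<in> arcs G" "t \<in> {0..len e'}"
  shows "tent e s (edge_map e' t) = (if e' = e then min s t - s * t / len e else 0)"
  unfolding tent_def by (subst from_edges_edge_map) (use assms len_pos[of e'] in auto)

text \<open>The slope is \<open>1 - s / len e\<close> before \<open>s\<close> and
  \<open>- s / len e\<close> after it, so pairing with \<open>f\<close> compares \<open>f\<close> at
  \<open>s\<close> with the linear interpolation between the ends of the edge. At
  \<open>s = 0\<close> and \<open>s = len e\<close> the tent vanishes and so do both sides; vertices
  thus fit the same formula.\<close>

lemma tent:
  assumes e: "e \<in> arcs G" and s: "s \<in> {0..len e}"
  shows tent_H1: "tent e s \<in> H1"
    and q_tent: "f \<in> H1 \<Longrightarrow> q (tent e s) f = f (edge_map e s)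
      - ((1 - s / len e) * f (Vertex (tail G e)) + s / len e * f (Vertex (head G e)))"
proof -
  let ?u = "\<lambda>e' t. if e' = e then min s t - s * t / len e else 0"
  let ?g = "\<lambda>e' t. if e' = e then indicator {0<..<s} t - s / len e else 0"
  have L2: "?g e' \<in> L2 (lebesgue_on {0<..<len e'})" for e'
  proof -
    interpret finite_measure "lebesgue_on {0<..<len e'}" by (rule finite_measure_interval)
    show ?thesis
    proof (cases "e' = e")
      case True
      have "{0<..<s} \<in> sets (lebesgue_on {0<..<len e})"
        using s by (auto simp: sets_restrict_space_iff)
      then have "(\<lambda>t. indicator {0<..<s} t - s / len e) \<in> borel_measurable (lebesgue_on {0<..<len e})"
        by (intro borel_measurable_diff borel_measurable_indicator) auto
      then show ?thesis
        using True s by (intro L2_bounded[where B = "1 + s / len e"]) (auto simp: indicator_def)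
    next
      case False
      then show ?thesis by (auto simp: L2_def)
    qed
  qed
  have deriv: "(?u e' has_real_derivative ?g e' t) (at t)" if t: "t \<in> {0<..<len e'} - {s}" for e' t
  proof (cases "e' = e")
    case True
    have lin: "((\<lambda>t. s * t / len e) has_real_derivative s / len e) (at t)"
      using e by (auto intro!: derivative_eq_intros)
    have "((\<lambda>t. min s t) has_real_derivative indicator {0<..<s} t) (at t)"
    proof (cases "t < s")
      case True
      have "((\<lambda>t. t) has_real_derivative indicator {0<..<s} t) (at t)"
        using True t by auto
      then show ?thesis
        by (rule has_field_derivative_transform_within_open[where S = "{..<s}"]) (use True in auto)
    next
      case False
      have "((\<lambda>t. s) has_real_derivative indicator {0<..<s} t) (at t)"
        using False t by auto
      then show ?thesis
        by (rule has_field_derivative_transform_within_open[where S = "{s<..}"]) (use False t in auto)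
    qed
    from DERIV_diff[OF this lin] show ?thesis using True by simp
  qed simp
  have cont: "continuous_on {0..len e'} (?u e')" for e'
    using e by (cases "e' = e") (auto intro!: continuous_intros)
  note H = from_edges_H1[of ?u "\<lambda>_. 0" "\<lambda>_. {s}" ?g, folded tent_def]
  show H1: "tent e s \<in> H1"
    by (rule H) (use e s deriv L2 cont in auto)
  assume f: "f \<in> H1"
  have "q (tent e s) f = (\<Sum>e'\<in>arcs G. \<integral>t. ?g e' t * edge_deriv e' f t \<partial>lebesgue_on {0<..<len e'})"
    by (rule H) (use e s deriv L2 cont f in auto)
  also have "\<dots> = (\<Sum>e'\<in>arcs G. if e' = e then \<integral>t. ?g e t * edge_deriv e f t \<partial>lebesgue_on {0<..<len e} else 0)"
    by (intro sum.cong) auto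
  also have "\<dots> = (\<integral>t. ?g e t * edge_deriv e f t \<partial>lebesgue_on {0<..<len e})"
    using e by simp
  also have "\<dots> = (\<integral>t. edge_deriv e f t * indicator {0<..<s} t
      - s / len e * (edge_deriv e f t * indicator {0<..<len e} t) \<partial>lebesgue_on {0<..<len e})"
    by (intro Bochner_Integration.integral_cong) (auto simp: algebra_simps)
  also have "\<dots> = (\<integral>t. edge_deriv e f t * indicator {0<..<s} t \<partial>lebesgue_on {0<..<len e})
      - s / len e * (\<integral>t. edge_deriv e f t * indicator {0<..<len e} t \<partial>lebesgue_on {0<..<len e})"
  proof -
    interpret finite_measure "lebesgue_on {0<..<len e}" by (rule finite_measure_interval)
    have "integrable (lebesgue_on {0<..<len e}) (\<lambda>t. edge_deriv e f t * indicator {0<..<r} t)" if "r \<le> len e" for r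
      using that by (intro integrable_real_mult_indicator L2_integrable edge_deriv_L2[OF f e])
        (auto simp: sets_restrict_space_iff)
    from this[of s] this[of "len e"] s show ?thesis by simp
  qed
  also have "\<dots> = (f (edge_map e s) - f (Vertex (tail G e)))
      - s / len e * (f (Vertex (head G e)) - f (Vertex (tail G e)))"
    using integral_edge_deriv[OF f e, of 0 s] integral_edge_deriv[OF f e, of 0 "len e"] s len_pos[OF e]
    by (simp add: edge_map_0 edge_map_len e)
  finally show "q (tent e s) f = f (edge_map e s)
      - ((1 - s / len e) * f (Vertex (tail G e)) + s / len e * f (Vertex (head G e)))"
    by (simp add: algebra_simps)
qed

end

text \<open>Riesz representation for a form that is only semidefinite: \<open>ker\<close>, the
  vanishing of \<open>l\<close> on null vectors, is the solvability condition. The induction is a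
  Gram-Schmidt step: the new direction is made orthogonal to the functions supported on the old set,
  and the solution gains a multiple of it.\<close>

lemma riesz_finite_support:
  fixes Q :: "('a \<Rightarrow> real) \<Rightarrow> ('a \<Rightarrow> real) \<Rightarrow> real" and l :: "('a \<Rightarrow> real) \<Rightarrow> real"
  assumes "finite S"
    and lin: "\<And>a b c d. Q (\<lambda>x. a x + c * b x) d = Q a d + c * Q b d"
    and sym: "\<And>a b. Q a b = Q b a" and nonneg: "\<And>a. 0 \<le> Q a a"
    and l: "\<And>a b c. l (\<lambda>x. a x + c * b x) = l a + c * l b"
    and ker: "\<And>a. (\<forall>x. x \<notin> S \<longrightarrow> a x = 0) \<Longrightarrow> Q a a = 0 \<Longrightarrow> l a = 0"
  shows "\<exists>a. (\<forall>x. x \<notin> S \<longrightarrow> a x = 0) \<and> (\<forall>b. (\<forall>x. x \<notin> S \<longrightarrow> b x = 0) \<longrightarrow> Q a b = l b)"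
  using assms(1) l ker
proof (induction S arbitrary: l)
  case empty
  have "l (\<lambda>_. 0) = 0" using empty.prems(1)[of "\<lambda>_. 0" "- 1" "\<lambda>_. 0"] by simp
  moreover have "Q (\<lambda>_. 0) (\<lambda>_. 0) = 0" using lin[of "\<lambda>_. 0" "- 1" "\<lambda>_. 0" "\<lambda>_. 0"] by simp
  ultimately show ?case by (auto simp: fun_eq_iff[symmetric])
next
  case (insert v S)
  note l = insert.prems(1) and ker = insert.prems(2)
  have lin_right: "Q d (\<lambda>x. a x + c * b x) = Q d a + c * Q d b" for a b c d
    using lin by (simp add: sym[of d])
  \<comment> \<open>Otherwise the form at a + c b is affine in c with nonzero slope, and the chosen
    c gives it the value -1. This is the condition \<open>ker\<close> for the functional
    \<open>Q \<delta>\<close>.\<close>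
  have null: "Q a b = 0" if "Q b b = 0" for a b
  proof (rule ccontr)
    assume "Q a b \<noteq> 0"
    define c where "c = - (Q a a + 1) / (2 * Q a b)"
    have "0 \<le> Q (\<lambda>x. a x + c * b x) (\<lambda>x. a x + c * b x)" by (rule nonneg)
    also have "\<dots> = Q a a + 2 * (c * Q a b)"
      using that by (simp add: lin lin_right sym[of b a])
    also have "\<dots> = - 1" using \<open>Q a b \<noteq> 0\<close> by (simp add: c_def field_simps)
    finally show False by simp
  qed
  obtain a0 where a0: "\<And>x. x \<notin> S \<Longrightarrow> a0 x = 0" "\<And>b. \<forall>x. x \<notin> S \<longrightarrow> b x = 0 \<Longrightarrow> Q a0 b = l b"
    using insert.IH[of l] l ker by auto
  define \<delta> where "\<delta> x = (if x = v then 1 else 0 :: real)" for x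
  \<comment> \<open>The projection of \<open>\<delta>\<close> onto the functions supported on
    \<open>S\<close>.\<close>
  obtain p where p: "\<And>x. x \<notin> S \<Longrightarrow> p x = 0" "\<And>b. \<forall>x. x \<notin> S \<longrightarrow> b x = 0 \<Longrightarrow> Q p b = Q \<delta> b"
    using insert.IH[of "Q \<delta>"] lin_right null by auto
  define w where "w x = \<delta> x + (- 1) * p x" for x
  have Q_w: "Q w b = 0" if "\<forall>x. x \<notin> S \<longrightarrow> b x = 0" for b
    using lin[of \<delta> "- 1" p b] p(2)[OF that] by (simp add: w_def [abs_def])
  define k where "k = l w / Q w w"
  have "\<forall>x. x \<notin> insert v S \<longrightarrow> w x = 0"
    using p(1) by (simp add: w_def \<delta>_def)
  \<comment> \<open>If \<open>Q w w\<close> is 0, both sides are 0 by \<open>ker\<close>.\<close>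
  from ker[OF this] have k: "k * Q w w = l w"
    by (cases "Q w w = 0") (auto simp: k_def)
  show ?case
  proof (intro exI conjI allI impI)
    show "a0 x + k * w x = 0" if "x \<notin> insert v S" for x
      using that a0(1) p(1) by (simp add: w_def \<delta>_def)
    fix b :: "'a \<Rightarrow> real" assume b: "\<forall>x. x \<notin> insert v S \<longrightarrow> b x = 0"
    \<comment> \<open>As \<open>w v\<close> is 1, this removes the component of \<open>b\<close> at
      \<open>v\<close> and leaves a function supported on \<open>S\<close>.\<close>
    define b' where "b' x = b x - b v * w x" for x
    have b': "\<forall>x. x \<notin> S \<longrightarrow> b' x = 0"
      using b p(1) insert.hyps by (auto simp: b'_def w_def \<delta>_def)
    have b_eq: "b = (\<lambda>x. b' x + b v * w x)" by (simp add: b'_def)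
    have "Q a0 w = 0" using Q_w[of a0] a0(1) sym by simp
    then have "Q a0 b = l b'"
      using lin_right[of a0 b' "b v" w] a0(2)[OF b'] b_eq by simp
    moreover have "Q w b = b v * Q w w"
      using lin_right[of w b' "b v" w] Q_w[OF b'] b_eq by simp
    moreover have "l b = l b' + b v * l w"
      using l[of b' "b v" w] b_eq by simp
    ultimately show "Q (\<lambda>x. a0 x + k * w x) b = l b"
      using k by (simp add: lin algebra_simps)
  qed
qed

context metric_graph
begin

subsection \<open>Dipole potentials\<close>

text \<open>The potential of a unit current entering at \<open>x\<close> and leaving at
  \<open>y\<close>. It is determined only up to a constant, hence a relation.\<close>

definition dipole :: "('v, 'e) mg_point \<Rightarrow> ('v, 'e) mg_point \<Rightarrow> (('v, 'e) mg_point \<Rightarrow> real) \<Rightarrow> bool" where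
  "dipole x y g \<longleftrightarrow> g \<in> H1 \<and> (\<forall>f\<in>H1. q g f = f x - f y)"

text \<open>The formula for affine extensions turns this into a linear problem for vertex values. It
  is solvable because a null vector is constant along the connected graph and so has equal values at
  \<open>u\<close> and \<open>r\<close>.\<close>

lemma dipole_vertices:
  assumes "u \<in> verts G" "r \<in> verts G"
  shows "\<exists>g. dipole (Vertex u) (Vertex r) g"
proof -
  define Q :: "('v \<Rightarrow> real) \<Rightarrow> ('v \<Rightarrow> real) \<Rightarrow> real" where
    "Q a b = (\<Sum>e\<in>arcs G. (a (head G e) - a (tail G e)) * (b (head G e) - b (tail G e)) / len e)" for a b
  have "\<exists>a. (\<forall>x. x \<notin> verts G \<longrightarrow> a x = 0) \<and>
      (\<forall>b. (\<forall>x. x \<notin> verts G \<longrightarrow> b x = 0) \<longrightarrow> Q a b = b u - b r)"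
  proof (rule riesz_finite_support)
    show "Q (\<lambda>x. a x + c * b x) d = Q a d + c * Q b d" for a b c d
      unfolding Q_def sum_distrib_left sum.distrib[symmetric]
      by (intro sum.cong) (auto simp: field_simps)
    show "Q a b = Q b a" for a b by (simp add: Q_def mult.commute)
    have summand: "0 \<le> (a (head G e) - a (tail G e)) * (a (head G e) - a (tail G e)) / len e"
      if "e \<in> arcs G" for e and a :: "'v \<Rightarrow> real"
      using len_pos[OF that] by simp
    then show "0 \<le> Q a a" for a by (auto simp: Q_def intro: sum_nonneg)
    fix a assume "Q a a = 0"
    then have flat: "a (head G e) = a (tail G e)" if "e \<in> arcs G" for e
      using that summand[of _ a] unfolding Q_def by (subst (asm) sum_nonneg_eq_0_iff) auto
    have "a u = a r"
      by (rule connected_induct[where r = r and P = "\<lambda>v. a v = a r"]) (use assms flat in auto)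
    then show "a u - a r = 0" by simp
  qed (auto simp: algebra_simps)
  then obtain a where a: "\<And>b. \<forall>x. x \<notin> verts G \<longrightarrow> b x = 0 \<Longrightarrow> Q a b = b u - b r"
    by blast
  have "q (affine_extension a) f = f (Vertex u) - f (Vertex r)" if f: "f \<in> H1" for f
  proof -
    define b where "b v = (if v \<in> verts G then f (Vertex v) else 0)" for v
    have "q (affine_extension a) f = Q a b"
      unfolding q_affine_extension[OF f] Q_def b_def by (intro sum.cong) auto
    also have "\<dots> = b u - b r" by (rule a) (simp add: b_def)
    finally show ?thesis using assms by (simp add: b_def)
  qed
  then show ?thesis
    using affine_extension_H1 by (auto simp: dipole_def)
qed

text \<open>Maximisation is done in edge coordinates: the resistance is jointly continuous on each
  of the finitely many rectangles \<open>{0..len e} \<times> {0..len e'}\<close>, and the largest of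
  their maxima is taken. The existential over \<open>g'\<close> also records that every pair of
  points has a dipole.\<close>

theorem exists_max_dipole:
  obtains x y g where "x \<in> points" "y \<in> points" "dipole x y g"
    "\<And>x' y'. x' \<in> points \<Longrightarrow> y' \<in> points \<Longrightarrow> \<exists>g'. dipole x' y' g' \<and> g' x' - g' y' \<le> g x - g y"
proof -
  obtain e0 where e0: "e0 \<in> arcs G" using arcs_nonempty by blast
  define r where "r = tail G e0"
  have r: "r \<in> verts G" using e0 by (simp add: r_def)
  define \<gamma> where "\<gamma> u = (SOME g. dipole (Vertex u) (Vertex r) g)" for u
  have \<gamma>: "dipole (Vertex u) (Vertex r) (\<gamma> u)" if "u \<in> verts G" for u
    unfolding \<gamma>_def using dipole_vertices[OF that r] by (rule someI_ex)
  have \<gamma>_H1: "\<gamma> (tail G e) \<in> H1" "\<gamma> (head G e) \<in> H1" if "e \<in> arcs G" for e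
    using \<gamma>[of "tail G e"] \<gamma>[of "head G e"] that by (auto simp: dipole_def)
  \<comment> \<open>the reproducing kernel of \<open>q\<close> on the functions vanishing at \<open>Vertex r\<close>\<close>
  define K where "K e s p = tent e s p + (1 - s / len e) * \<gamma> (tail G e) p + s / len e * \<gamma> (head G e) p" for e s p
  have K: "K e s \<in> H1" "f \<in> H1 \<Longrightarrow> q (K e s) f = f (edge_map e s) - f (Vertex r)"
    if e: "e \<in> arcs G" and s: "s \<in> {0..len e}" for e s f
  proof -
    let ?h = "\<lambda>p. tent e s p + (1 - s / len e) * \<gamma> (tail G e) p"
    have h: "?h \<in> H1"
      by (intro H1_add_cmult tent_H1 e s \<gamma>_H1)
    show "K e s \<in> H1"
      unfolding K_def [abs_def] by (intro H1_add_cmult[OF h] \<gamma>_H1 e)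
    assume f: "f \<in> H1"
    have "q (K e s) f = q ?h f + s / len e * q (\<gamma> (head G e)) f"
      unfolding K_def [abs_def] by (intro q_add_cmult_left h \<gamma>_H1 e f)
    also have "q ?h f = q (tent e s) f + (1 - s / len e) * q (\<gamma> (tail G e)) f"
      by (intro q_add_cmult_left tent_H1 \<gamma>_H1 e f s)
    finally show "q (K e s) f = f (edge_map e s) - f (Vertex r)" 
    proof (elim ssubst)
      have "q (\<gamma> (tail G e)) f = f (Vertex (tail G e)) - f (Vertex r)" "q (\<gamma> (head G e)) f = f (Vertex (head G e)) - f (Vertex r)"
        using \<gamma>[of "tail G e"] \<gamma>[of "head G e"] e f by (simp_all add: dipole_def)
      \<comment> \<open>The vertex dipoles restore the interpolation subtracted by the tent; their
        weights add up to 1, so the value at \<open>Vertex r\<close> is subtracted exactly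
        once.\<close>
      moreover have "x - ((1 - c) * a + c * b) + (1 - c) * (a - r) + c * (b - r) = x - r" for a b c r x :: real
        by (simp add: algebra_simps)
      ultimately show "q (tent e s) f + (1 - s / len e) * q (\<gamma> (tail G e)) f + s / len e * q (\<gamma> (head G e)) f
        = f (edge_map e s) - f (Vertex r)" by (simp only: q_tent[OF e s f])
    qed
  qed
  \<comment> \<open>In the difference of two kernels the values at \<open>Vertex r\<close>
    cancel.\<close>
  define g where "g e e' s s' p = K e s p + (- 1) * K e' s' p" for e e' s s' p
  have g: "dipole (edge_map e s) (edge_map e' s') (g e e' s s')"
    if "e \<in> arcs G" "e' \<in> arcs G" "s \<in> {0..len e}" "s' \<in> {0..len e'}" for e e' s s'
    unfolding dipole_def g_def [abs_def]
  proof (intro conjI ballI H1_add_cmult K that)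
    fix f assume f: "f \<in> H1"
    have "q (\<lambda>p. K e s p + (- 1) * K e' s' p) f = q (K e s) f + (- 1) * q (K e' s') f"
      by (intro q_add_cmult_left K that f)
    then show "q (\<lambda>p. K e s p + (- 1) * K e' s' p) f = f (edge_map e s) - f (edge_map e' s')"
      using K(2) that f by simp
  qed
  \<comment> \<open>The effective resistance between the points with parameters \<open>fst z\<close>
    on \<open>e\<close> and \<open>snd z\<close> on \<open>e'\<close>.\<close>
  define F where "F e e' z = g e e' (fst z) (snd z) (edge_map e (fst z)) - g e e' (fst z) (snd z) (edge_map e' (snd z))" for e e' z
  have \<gamma>_cont: "continuous_on A (\<lambda>z. \<gamma> u (edge_map e (h z)))"
    if "e \<in> arcs G" "u \<in> verts G" "continuous_on A h" "\<And>z. z \<in> A \<Longrightarrow> h z \<in> {0..len e}" for A e u and h :: "real \<times> real \<Rightarrow> real"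
  proof -
    have "\<gamma> u \<in> H1" using \<gamma>[OF that(2)] by (simp add: dipole_def)
    then show ?thesis
      using continuous_on_compose2[OF H1_edge(1)[OF _ that(1)] that(3)] that(4) by blast
  qed
  have tent_cont: "continuous_on A (\<lambda>z. tent e (h z) (edge_map e' (h' z)))"
    if e: "e \<in> arcs G" "e' \<in> arcs G" and h: "continuous_on A h" "continuous_on A h'"
      and "\<And>z. z \<in> A \<Longrightarrow> h z \<in> {0..len e}" "\<And>z. z \<in> A \<Longrightarrow> h' z \<in> {0..len e'}" for A e e' and h h' :: "real \<times> real \<Rightarrow> real"
  proof -
    have "continuous_on A (\<lambda>z. if e' = e then min (h z) (h' z) - h z * h' z / len e else 0)"
      using e h by (cases "e' = e") (auto intro!: continuous_intros)
    then show ?thesis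
      using that by (subst continuous_on_cong[OF refl tent_edge_map]) auto
  qed
  have F_cont: "continuous_on ({0..len e} \<times> {0..len e'}) (F e e')" if "e \<in> arcs G" "e' \<in> arcs G" for e e'
    unfolding F_def g_def K_def
    by (intro continuous_intros \<gamma>_cont tent_cont) (use that in auto)
  have "\<exists>z\<in>{0..len e} \<times> {0..len e'}. \<forall>z'\<in>{0..len e} \<times> {0..len e'}. F e e' z' \<le> F e e' z"
    if "e \<in> arcs G" "e' \<in> arcs G" for e e'
    using that len_pos[of e] len_pos[of e']
    by (intro continuous_attains_sup F_cont compact_Times) auto
  then obtain z where z: "\<And>e e'. e \<in> arcs G \<Longrightarrow> e' \<in> arcs G \<Longrightarrow> z e e' \<in> {0..len e} \<times> {0..len e'}"
    "\<And>e e' z'. e \<in> arcs G \<Longrightarrow> e' \<in> arcs G \<Longrightarrow> z' \<in> {0..len e} \<times> {0..len e'} \<Longrightarrow> F e e' z' \<le> F e e' (z e e')"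
    by metis
  let ?m = "\<lambda>(e, e'). F e e' (z e e')"
  have fin: "finite (?m ` (arcs G \<times> arcs G))" "?m ` (arcs G \<times> arcs G) \<noteq> {}"
    using arcs_nonempty by auto
  from Max_in[OF this] obtain e1 e2 where e12: "e1 \<in> arcs G" "e2 \<in> arcs G"
    and "Max (?m ` (arcs G \<times> arcs G)) = F e1 e2 (z e1 e2)" by auto
  then have max: "F e e' (z e e') \<le> F e1 e2 (z e1 e2)" if "e \<in> arcs G" "e' \<in> arcs G" for e e'
    using Max_ge[OF fin(1), of "F e e' (z e e')"] that by force
  obtain s1 s2 where s12: "z e1 e2 = (s1, s2)" by fastforce
  with z(1)[OF e12] have s: "s1 \<in> {0..len e1}" "s2 \<in> {0..len e2}" by auto
  show ?thesis
  proof (rule that)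
    show "edge_map e1 s1 \<in> points" "edge_map e2 s2 \<in> points"
      by (rule edge_map_in_points; fact)+
    show "dipole (edge_map e1 s1) (edge_map e2 s2) (g e1 e2 s1 s2)"
      by (rule g) fact+
    fix x' y' assume "x' \<in> points" "y' \<in> points"
    then obtain e s' e' t' where et: "e \<in> arcs G" "s' \<in> {0..len e}" "x' = edge_map e s'"
        "e' \<in> arcs G" "t' \<in> {0..len e'}" "y' = edge_map e' t'"
      by (metis points_edge_map)
    have "F e e' (s', t') \<le> F e1 e2 (z e1 e2)"
      using z(2)[of e e' "(s', t')"] max[of e e'] et by fastforce
    then show "\<exists>g'. dipole x' y' g' \<and> g' x' - g' y'
        \<le> g e1 e2 s1 s2 (edge_map e1 s1) - g e1 e2 s1 s2 (edge_map e2 s2)"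
      using g[of e e' s' t'] et by (auto simp: F_def s12)
  qed
qed

text \<open>The tent at an inner point has its strict maximum there, which separates this point from
  all others; two vertices are told apart by the affine extension of an indicator.\<close>

lemma H1_separates:
  assumes "x \<in> points" "y \<in> points" "x \<noteq> y"
  obtains f where "f \<in> H1" "f x \<noteq> f y"
proof -
  have inner: "\<exists>f\<in>H1. f x \<noteq> f y" if x: "x = Inner e s" and "x \<in> points" "y \<in> points" "x \<noteq> y" for x y e s
  proof (rule bexI)
    have e: "e \<in> arcs G" and s: "0 < s" "s < len e"
      using that by (auto simp: points_def)
    then show "tent e s \<in> H1" by (intro tent_H1) auto
    have x': "x = edge_map e s" using x s by (simp add: edge_map_def)
    obtain e' t where y: "e' \<in> arcs G" "t \<in> {0..len e'}" "y = edge_map e' t"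
      using \<open>y \<in> points\<close> by (rule points_edge_map)
    have "tent e s x = s * (len e - s) / len e"
      using e s len_neq_0[OF e] unfolding x' by (subst tent_edge_map) (auto simp: field_simps)
    moreover have "tent e s y < s * (len e - s) / len e"
    proof (cases "e' = e")
      case True
      then have "t \<noteq> s" using \<open>x \<noteq> y\<close> x' y by auto
      then have "min s t - s * t / len e < s * (len e - s) / len e"
      proof (cases "t < s")
        case True
        have "t * (len e - s) / len e < s * (len e - s) / len e"
          using True s by (intro divide_strict_right_mono) auto
        moreover have "t - s * t / len e = t * (len e - s) / len e"
          using s by (simp add: field_simps)
        ultimately show ?thesis using True by simp
      next
        case False
        then have "s * (len e - t) / len e < s * (len e - s) / len e"
          using \<open>t \<noteq> s\<close> s by (intro divide_strict_right_mono) auto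
        moreover have "s - s * t / len e = s * (len e - t) / len e"
          using s by (simp add: field_simps)
        ultimately show ?thesis using False by simp
      qed
      then show ?thesis using True y s by (simp add: tent_edge_map)
    next
      case False
      then show ?thesis using y s by (simp add: tent_edge_map)
    qed
    ultimately show "tent e s x \<noteq> tent e s y" by simp
  qed
  show ?thesis
  proof (cases x)
    case (Inner e s)
    then show ?thesis using inner[of x e s y] assms that by blast
  next
    case x: (Vertex u)
    show ?thesis
    proof (cases y)
      case (Inner e s)
      then show ?thesis using inner[of y e s x] assms that by metis
    next
      case (Vertex v)
      have "affine_extension (\<lambda>w. if w = u then 1 else 0) x \<noteq> affine_extension (\<lambda>w. if w = u then 1 else 0) y"
        using x Vertex assms by (simp add: affine_extension_def from_edges_def)
      then show ?thesis using that affine_extension_H1 by blast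
    qed
  qed
qed

end

section \<open>Integrals over two atoms, and dimensions of function spaces\<close>

lemma (in finite_measure) integral_two_points:
  fixes h :: "'a \<Rightarrow> real"
  assumes "{x} \<in> sets M" "{y} \<in> sets M" "x \<noteq> y" "AE p in M. p \<in> {x, y}" "h \<in> borel_measurable M"
  shows "(\<integral>p. h p \<partial>M) = h x * measure M {x} + h y * measure M {y}"
proof -
  have "(\<integral>p. h p \<partial>M) = (\<integral>p. h x * indicator {x} p + h y * indicator {y} p \<partial>M)"
  proof (rule integral_cong_AE)
    show "AE p in M. h p = h x * indicator {x} p + h y * indicator {y} p"
      using assms(4) by eventually_elim (use assms(3) in auto)
  qed (use assms in auto)
  also have "\<dots> = h x * measure M {x} + h y * measure M {y}"
    using assms by (subst Bochner_Integration.integral_add) (auto simp: less_top[symmetric])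
  finally show ?thesis .
qed

lemma real_fun_dim_range:
  fixes h :: "'a \<Rightarrow> real"
  assumes "h \<noteq> (\<lambda>_. 0)"
  shows "real_fun.dim (range (\<lambda>c x. c * h x)) = 1"
proof -
  have "range (\<lambda>c x. c * h x) = real_fun.span {h}"
    by (rule real_fun.span_singleton[symmetric])
  moreover have "\<not> real_fun.dependent {h}"
    using assms by (simp add: zero_fun_def)
  ultimately show ?thesis
    using real_fun.dim_eq_card_independent[of "{h}"] by (simp add: real_fun.dim_span)
qed

text \<open>This turns a nonzero \<open>eigen_mult\<close> into an eigenfunction. The converse fails
  in general, since \<open>real_fun.dim\<close> is 0 also on infinite-dimensional spaces.\<close>

lemma real_fun_dim_neq_0:
  fixes V :: "('a \<Rightarrow> real) set"
  assumes "real_fun.dim V \<noteq> 0"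
  shows "\<exists>f\<in>V. f \<noteq> (\<lambda>_. 0)"
proof (rule ccontr)
  assume "\<not> ?thesis"
  then have "V \<subseteq> real_fun.span {}" by (auto simp: zero_fun_def)
  then have "real_fun.dim V \<le> card ({} :: ('a \<Rightarrow> real) set)"
    by (rule real_fun.dim_le_card) simp
  with assms show False by simp
qed

context metric_graph
begin

subsection \<open>Functions and measures\<close>

lemma q_square_expand:
  assumes "f \<in> H1" "g \<in> H1"
  shows "q (\<lambda>p. f p + c * g p) (\<lambda>p. f p + c * g p) = q f f + 2 * c * q f g + c\<^sup>2 * q g g"
proof -
  have "(\<lambda>p. f p + c * g p) \<in> H1" using assms by (rule H1_add_cmult)
  then show ?thesis
    using assms q_commute[of g f]
    by (simp add: q_add_cmult_left q_add_cmult_right power2_eq_square algebra_simps)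
qed

lemma q_cauchy_schwarz:
  assumes "f \<in> H1" "g \<in> H1"
  shows "(q f g)\<^sup>2 \<le> q f f * q g g"
proof -
  have expand: "0 \<le> q f f + 2 * c * q f g + c\<^sup>2 * q g g" for c
    using q_nonneg q_square_expand[OF assms] by metis
  show ?thesis
  proof (cases "q g g = 0")
    case True
    have "q f g = 0"
    proof (rule ccontr)
      assume "q f g \<noteq> 0"
      \<comment> \<open>With \<open>q g g\<close> = 0 the quadratic is affine in c, and this c gives
        it the value -1.\<close>
      then show False
        using expand[of "- (q f f + 1) / (2 * q f g)"] True by (simp add: field_simps)
    qed
    with True show ?thesis by simp
  next
    case False
    then have pos: "0 < q g g" using q_nonneg[of g] by simp
    have "0 \<le> (q f f + 2 * (- q f g / q g g) * q f g + (- q f g / q g g)\<^sup>2 * q g g) * q g g"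
      using expand[of "- q f g / q g g"] pos by (intro mult_nonneg_nonneg) auto
    also have "\<dots> = q f f * q g g - (q f g)\<^sup>2"
      using pos by (simp add: power2_eq_square field_simps)
    finally show ?thesis by simp
  qed
qed

lemma H1_attains_max:
  assumes f: "f \<in> H1"
  obtains x where "x \<in> points" "\<And>p. p \<in> points \<Longrightarrow> f p \<le> f x"
proof -
  have "\<exists>t\<in>{0..len e}. \<forall>s\<in>{0..len e}. f (edge_map e s) \<le> f (edge_map e t)" if "e \<in> arcs G" for e
    using len_pos[OF that] by (intro continuous_attains_sup H1_edge f that) auto
  then obtain t where t: "\<And>e. e \<in> arcs G \<Longrightarrow> t e \<in> {0..len e}"
    "\<And>e s. e \<in> arcs G \<Longrightarrow> s \<in> {0..len e} \<Longrightarrow> f (edge_map e s) \<le> f (edge_map e (t e))"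
    by metis
  let ?m = "\<lambda>e. f (edge_map e (t e))"
  have fin: "finite (?m ` arcs G)" "?m ` arcs G \<noteq> {}" using arcs_nonempty by auto
  from Max_in[OF this] obtain e where e: "e \<in> arcs G" "Max (?m ` arcs G) = ?m e" by auto
  show ?thesis
  proof (rule that)
    show "edge_map e (t e) \<in> points" using e t by (intro edge_map_in_points)
    fix p assume "p \<in> points"
    then obtain d s where d: "d \<in> arcs G" "s \<in> {0..len d}" "p = edge_map d s"
      by (rule points_edge_map)
    have "f p \<le> ?m d" using t(2) d by simp
    also have "\<dots> \<le> ?m e" using Max_ge[OF fin(1), of "?m d"] d e by simp
    finally show "f p \<le> f (edge_map e (t e))" .
  qed
qed

lemma H1_attains_min:
  assumes f: "f \<in> H1"
  obtains x where "x \<in> points" "\<And>p. p \<in> points \<Longrightarrow> f x \<le> f p"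
proof -
  \<comment> \<open>This is -f in the shape of \<open>H1_add_cmult\<close>.\<close>
  have "(\<lambda>p. f p + (- 2) * f p) \<in> H1" using f f by (rule H1_add_cmult)
  then obtain x where "x \<in> points" "\<And>p. p \<in> points \<Longrightarrow> f p + (- 2) * f p \<le> f x + (- 2) * f x"
    by (rule H1_attains_max) blast
  then show ?thesis using that[of x] by force
qed

section \<open>Measurability, constants and two-point measures\<close>

lemma openin_imp_sets: "openin mg_topology U \<Longrightarrow> U \<in> sets mg_borel"
  unfolding mg_borel_def
  by (subst sets_measure_of) (auto simp: openin_mg_topology)

lemma space_borel_prob: "\<mu> \<in> borel_prob_measures \<Longrightarrow> space \<mu> = points"
  using sets_eq_imp_space_eq[of \<mu> mg_borel] by (simp add: borel_prob_measures_def space_mg_borel)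

lemma H1_measurable:
  assumes "\<mu> \<in> borel_prob_measures" "f \<in> H1"
  shows "f \<in> borel_measurable \<mu>"
proof (rule borel_measurableI)
  fix S :: "real set" assume "open S"
  then have "openin mg_topology {p \<in> points. f p \<in> S}"
    using assms(2) by (auto simp: H1_def continuous_map_def topspace_mg_topology)
  moreover have "{p \<in> points. f p \<in> S} = f -` S \<inter> space \<mu>"
    using space_borel_prob[OF assms(1)] by auto
  ultimately show "f -` S \<inter> space \<mu> \<in> sets \<mu>"
    using openin_imp_sets assms(1) by (auto simp: borel_prob_measures_def)
qed

lemma H1_L2:
  assumes "\<mu> \<in> borel_prob_measures" "f \<in> H1"
  shows "f \<in> L2 \<mu>"
proof -
  interpret prob_space \<mu> using assms(1) by (simp add: borel_prob_measures_def)
  obtain x where x: "\<And>p. p \<in> points \<Longrightarrow> f p \<le> f x" using H1_attains_max[OF assms(2)] by metis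
  obtain y where y: "\<And>p. p \<in> points \<Longrightarrow> f y \<le> f p" using H1_attains_min[OF assms(2)] by metis
  show ?thesis
  proof (rule L2_bounded[OF H1_measurable[OF assms]])
    fix p assume "p \<in> space \<mu>"
    then show "\<bar>f p\<bar> \<le> \<bar>f x\<bar> + \<bar>f y\<bar>"
      using x[of p] y[of p] space_borel_prob[OF assms(1)] by auto
  qed
qed

text \<open>Points are closed, since each edge map takes a given value at only finitely many
  parameters.\<close>

lemma singleton_in_sets:
  assumes "p \<in> points"
  shows "{p} \<in> sets mg_borel"
proof -
  have "openin mg_topology (points - {p})"
    unfolding openin_mg_topology
  proof (intro conjI ballI)
    fix e assume e: "e \<in> arcs G"
    have "{t. edge_map e t = p} \<subseteq> {0, len e, (case p of Vertex v \<Rightarrow> 0 | Inner _ s \<Rightarrow> s)}"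
      by (auto simp: edge_map_def split: if_splits)
    then have "finite {t. edge_map e t = p}" by (rule finite_subset) simp
    then have "open (- {t. edge_map e t = p})" by (intro open_Compl finite_imp_closed)
    then have "openin (top_of_set {0..len e}) ({0..len e} \<inter> - {t. edge_map e t = p})"
      by (rule openin_open_Int)
    moreover have "{0..len e} \<inter> - {t. edge_map e t = p} = {t \<in> {0..len e}. edge_map e t \<in> points - {p}}"
      using edge_map_in_points[OF e] by auto
    ultimately show "openin (top_of_set {0..len e}) {t \<in> {0..len e}. edge_map e t \<in> points - {p}}"
      by simp
  qed auto
  then have "points - (points - {p}) \<in> sets mg_borel"
    using openin_imp_sets sets.compl_sets space_mg_borel by metis
  moreover have "points - (points - {p}) = {p}" using assms by auto
  ultimately show ?thesis by simp
qed

text \<open>The constant 1 with the extension by 0 that \<open>H1\<close> demands; as an affine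
  extension it has zero energy against every function.\<close>

definition one :: "('v, 'e) mg_point \<Rightarrow> real" where
  "one = affine_extension (\<lambda>_. 1)"

lemma one_eq: "one p = (if p \<in> points then 1 else 0)"
  by (auto simp: one_def affine_extension_def from_edges_def split: mg_point.split)

lemma one_H1: "one \<in> H1"
  unfolding one_def by (rule affine_extension_H1)

lemma q_one: "f \<in> H1 \<Longrightarrow> q one f = 0" "f \<in> H1 \<Longrightarrow> q f one = 0"
  unfolding one_def by (simp_all add: q_affine_extension q_commute[of f])

lemma emeasure_half_dirac_sum_ennreal:
  assumes "A \<in> sets mg_borel"
  shows "emeasure (half_dirac_sum x y) A = ennreal ((indicator A x + indicator A y) / 2)"
proof -
  have half: "(1/2 :: ennreal) = ennreal (1/2)"
    using divide_ennreal[of 1 2] by simp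
  have "ennreal (1/2 + 1/2) = ennreal (1/2) + ennreal (1/2)"
    by (rule ennreal_plus) simp_all
  then have "ennreal (1/2) + ennreal (1/2) = 1"
    by (simp only: field_sum_of_halves ennreal_1)
  then show ?thesis
    unfolding emeasure_half_dirac_sum[OF assms] half by (simp add: indicator_def)
qed

lemma measure_half_dirac_sum:
  assumes "A \<in> sets mg_borel"
  shows "measure (half_dirac_sum x y) A = (indicator A x + indicator A y) / 2"
  unfolding measure_def emeasure_half_dirac_sum_ennreal[OF assms] by (rule enn2real_ennreal) simp

lemma half_dirac_sum_borel_prob:
  assumes "x \<in> points" "y \<in> points"
  shows "half_dirac_sum x y \<in> borel_prob_measures"
proof -
  have "points \<in> sets mg_borel" using sets.top[of mg_borel] by (simp add: space_mg_borel)
  then have "emeasure (half_dirac_sum x y) points = 1"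
    using assms by (simp add: emeasure_half_dirac_sum_ennreal)
  moreover have "space (half_dirac_sum x y) = points"
    using sets_eq_imp_space_eq[OF sets_half_dirac_sum] by (simp add: space_mg_borel)
  ultimately show ?thesis
    by (simp add: borel_prob_measures_def sets_half_dirac_sum prob_spaceI)
qed

subsection \<open>Eigenspaces\<close>

lemma H1_on_add_cmult:
  assumes "f \<in> H1_on \<mu>" "g \<in> H1_on \<mu>"
  shows "(\<lambda>p. f p + c * g p) \<in> H1_on \<mu>"
  using assms by (auto simp: H1_on_def harmonic_on_def H1_add_cmult q_add_cmult_left)

lemma one_H1_on: "one \<in> H1_on \<mu>"
  by (simp add: H1_on_def harmonic_on_def one_H1 q_one)

text \<open>The last claim comes from testing with the constant \<open>one\<close>; for nonzero
  \<open>s\<close> it says that \<open>f\<close> has mean 0.\<close>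

lemma eigenspaceD:
  assumes \<mu>: "\<mu> \<in> borel_prob_measures" and f: "f \<in> eigenspace \<mu> s"
  shows "f \<in> H1_on \<mu>" "f \<in> H1"
    "\<phi> \<in> H1_on \<mu> \<Longrightarrow> q f \<phi> = s * (\<integral>p. f p * \<phi> p \<partial>\<mu>)"
    "s * (\<integral>p. f p \<partial>\<mu>) = 0"
proof -
  show H: "f \<in> H1_on \<mu>" "f \<in> H1"
    using f by (auto simp: eigenspace_def H_rel_def H1_on_def)
  show q: "q f \<phi> = s * (\<integral>p. f p * \<phi> p \<partial>\<mu>)" if "\<phi> \<in> H1_on \<mu>" for \<phi>
    using f that by (simp add: eigenspace_def H_rel_def mult.assoc)
  have "(\<integral>p. f p * one p \<partial>\<mu>) = (\<integral>p. f p \<partial>\<mu>)"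
    using space_borel_prob[OF \<mu>] by (intro Bochner_Integration.integral_cong) (auto simp: one_eq)
  then show "s * (\<integral>p. f p \<partial>\<mu>) = 0"
    using q[OF one_H1_on] q_one H by simp
qed

lemma eigenspaceI:
  assumes "\<mu> \<in> borel_prob_measures" "f \<in> H1_on \<mu>"
    "\<And>\<phi>. \<phi> \<in> H1_on \<mu> \<Longrightarrow> q f \<phi> = s * (\<integral>p. f p * \<phi> p \<partial>\<mu>)"
  shows "f \<in> eigenspace \<mu> s"
proof -
  have f: "f \<in> H1" using assms(2) by (simp add: H1_on_def)
  have "(\<lambda>p. f p + (s - 1) * f p) \<in> L2 \<mu>"
    by (intro L2_add_cmult H1_L2 assms f)
  then have "(\<lambda>p. s * f p) \<in> L2 \<mu>" by (simp add: algebra_simps)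
  then show ?thesis
    using assms by (simp add: eigenspace_def H_rel_def mult.assoc)
qed

lemma eigenspace_add_cmult:
  assumes \<mu>: "\<mu> \<in> borel_prob_measures" and "f \<in> eigenspace \<mu> s" "g \<in> eigenspace \<mu> s"
  shows "(\<lambda>p. f p + c * g p) \<in> eigenspace \<mu> s"
proof (rule eigenspaceI[OF \<mu>])
  note f = eigenspaceD[OF \<mu> assms(2)] and g = eigenspaceD[OF \<mu> assms(3)]
  show "(\<lambda>p. f p + c * g p) \<in> H1_on \<mu>" using f(1) g(1) by (rule H1_on_add_cmult)
  fix \<phi> assume \<phi>: "\<phi> \<in> H1_on \<mu>"
  then have \<phi>': "\<phi> \<in> H1" by (simp add: H1_on_def)
  have "integrable \<mu> (\<lambda>p. f p * \<phi> p)" "integrable \<mu> (\<lambda>p. g p * \<phi> p)"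
    using f(2) g(2) \<phi>' H1_L2[OF \<mu>] by (auto intro: L2_mult_integrable)
  then have "(\<integral>p. f p * \<phi> p + c * (g p * \<phi> p) \<partial>\<mu>) = (\<integral>p. f p * \<phi> p \<partial>\<mu>) + c * (\<integral>p. g p * \<phi> p \<partial>\<mu>)"
    by simp
  then show "q (\<lambda>p. f p + c * g p) \<phi> = s * (\<integral>p. (f p + c * g p) * \<phi> p \<partial>\<mu>)"
    using f g \<phi> \<phi>' by (simp add: q_add_cmult_left algebra_simps)
qed

lemma H1_constant:
  assumes "f \<in> H1" "q f f = 0" "x \<in> points"
  shows "f = (\<lambda>p. f x * one p)"
proof
  fix p
  show "f p = f x * one p"
    using q_eq_0_imp_constant[OF assms(1,2) _ assms(3)] assms(1) by (auto simp: one_eq H1_iff)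
qed

lemma points_nonempty: "\<exists>x. x \<in> points"
proof -
  obtain e where "e \<in> arcs G" using arcs_nonempty by blast
  then have "Vertex (tail G e) \<in> points" by (simp add: points_def)
  then show ?thesis by blast
qed

lemma eigenspace_0:
  assumes \<mu>: "\<mu> \<in> borel_prob_measures"
  shows "eigenspace \<mu> 0 = range (\<lambda>c p. c * one p)"
proof
  obtain x where x: "x \<in> points" using points_nonempty by blast
  show "eigenspace \<mu> 0 \<subseteq> range (\<lambda>c p. c * one p)"
  proof
    fix f assume f: "f \<in> eigenspace \<mu> 0"
    note D = eigenspaceD[OF \<mu> f]
    have "f = (\<lambda>p. f x * one p)" using D(3)[OF D(1)] by (intro H1_constant D x) simp
    then show "f \<in> range (\<lambda>c p. c * one p)" by blast
  qed
  have one: "one \<in> eigenspace \<mu> 0"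
    by (rule eigenspaceI[OF \<mu> one_H1_on]) (auto simp: H1_on_def q_one)
  have "(\<lambda>p. c * one p) \<in> eigenspace \<mu> 0" for c
    using eigenspace_add_cmult[OF \<mu> one one, of "c - 1"] by (simp add: algebra_simps)
  then show "range (\<lambda>c p. c * one p) \<subseteq> eigenspace \<mu> 0" by blast
qed

lemma eigen_mult_0:
  assumes "\<mu> \<in> borel_prob_measures"
  shows "eigen_mult \<mu> 0 = 1"
proof -
  have "one \<noteq> (\<lambda>_. 0)" using points_nonempty by (auto simp: fun_eq_iff one_eq)
  then show ?thesis
    unfolding eigen_mult_def eigenspace_0[OF assms] by (rule real_fun_dim_range)
qed

text \<open>A sum over an infinite index set is 0 by convention, so a count above 1 forces
  finiteness. The eigenvalue 0 contributes exactly 1, so another one must lie below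
  \<open>r\<close>.\<close>

lemma eigenvalue_count_gt_1:
  assumes \<mu>: "\<mu> \<in> borel_prob_measures" and "1 < eigenvalue_count \<mu> r"
  shows "finite {s. s \<le> r \<and> eigen_mult \<mu> s \<noteq> 0}" "\<exists>s\<le>r. s \<noteq> 0 \<and> eigen_mult \<mu> s \<noteq> 0"
proof -
  let ?S = "{s. s \<le> r \<and> eigen_mult \<mu> s \<noteq> 0}"
  show fin: "finite ?S"
    using assms(2) unfolding eigenvalue_count_def by (metis sum.infinite not_less_zero)
  show "\<exists>s\<le>r. s \<noteq> 0 \<and> eigen_mult \<mu> s \<noteq> 0"
  proof (rule ccontr)
    assume "\<not> ?thesis"
    then have "?S \<subseteq> {0}" by auto
    then have "sum (eigen_mult \<mu>) ?S \<le> sum (eigen_mult \<mu>) {0}" by (intro sum_mono2) auto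
    then show False using assms eigen_mult_0[OF \<mu>] by (simp add: eigenvalue_count_def)
  qed
qed

text \<open>An eigenfunction that vanishes in the space of square integrable functions has no
  energy, so it is constant, and a probability measure sees every nonzero constant.\<close>

lemma integral_square_pos:
  assumes \<mu>: "\<mu> \<in> borel_prob_measures" and f: "f \<in> eigenspace \<mu> s" "f \<noteq> (\<lambda>_. 0)"
  shows "0 < (\<integral>p. (f p)\<^sup>2 \<partial>\<mu>)"
proof (rule ccontr)
  interpret prob_space \<mu> using \<mu> by (simp add: borel_prob_measures_def)
  note D = eigenspaceD[OF \<mu> f(1)]
  assume "\<not> ?thesis"
  moreover have "0 \<le> (\<integral>p. (f p)\<^sup>2 \<partial>\<mu>)" by simp
  ultimately have 0: "(\<integral>p. (f p)\<^sup>2 \<partial>\<mu>) = 0" by linarith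
  obtain x where x: "x \<in> points" using points_nonempty by blast
  have "q f f = 0" using D(3)[OF D(1)] 0 by (simp add: power2_eq_square)
  then have const: "f = (\<lambda>p. f x * one p)" using D x by (intro H1_constant)
  have "f p = f x" if "p \<in> points" for p
    using fun_cong[OF const, of p] that by (simp add: one_eq)
  then have "(\<integral>p. (f p)\<^sup>2 \<partial>\<mu>) = (\<integral>p. (f x)\<^sup>2 \<partial>\<mu>)"
    by (intro Bochner_Integration.integral_cong) (simp_all add: space_borel_prob[OF \<mu>])
  then have "f x = 0" using 0 by (simp add: prob_space)
  then have "f = (\<lambda>_. 0)" by (subst const) simp
  then show False using f(2) by contradiction
qed

subsection \<open>Effective resistance\<close>

lemma dipole_bound:
  assumes "dipole x y g" "f \<in> H1"
  shows "(f x - f y)\<^sup>2 \<le> (g x - g y) * q f f"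
  using q_cauchy_schwarz[of g f] assms by (auto simp: dipole_def)

text \<open>The equality case of Cauchy-Schwarz: subtracting the right multiple of \<open>g\<close>
  from \<open>f\<close> leaves a function without energy, which is orthogonal to everything. Stating
  this through \<open>q f\<close> avoids the free additive constant.\<close>

lemma dipole_bound_eq:
  assumes g: "dipole x y g" "0 < g x - g y" and f: "f \<in> H1" and eq: "(f x - f y)\<^sup>2 = (g x - g y) * q f f"
    and \<phi>: "\<phi> \<in> H1"
  shows "q f \<phi> = (f x - f y) / (g x - g y) * (\<phi> x - \<phi> y)"
proof -
  define c where "c = - ((f x - f y) / (g x - g y))"
  have gH: "g \<in> H1" and qg: "\<And>h. h \<in> H1 \<Longrightarrow> q g h = h x - h y" using g(1) by (auto simp: dipole_def)
  define h where "h = (\<lambda>p. f p + c * g p)"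
  have h: "h \<in> H1" unfolding h_def using f gH by (rule H1_add_cmult)
  have "q h h = q f f + 2 * c * (f x - f y) + c\<^sup>2 * (g x - g y)"
    unfolding h_def q_square_expand[OF f gH] q_commute[of f g] qg[OF f] qg[OF gH] ..
  also have "\<dots> = 0"
  proof -
    have "d\<^sup>2 / R + 2 * (- (d / R)) * d + (- (d / R))\<^sup>2 * R = 0" if "0 < R" for d R :: real
      using that by (simp add: power2_eq_square)
    moreover have "q f f = (f x - f y)\<^sup>2 / (g x - g y)"
      using g(2) unfolding eq by simp
    ultimately show ?thesis
      using g(2) unfolding c_def by metis
  qed
  finally have "(q h \<phi>)\<^sup>2 \<le> 0" using q_cauchy_schwarz[OF h \<phi>] by simp
  then have "q h \<phi> = 0" by simp
  then show ?thesis
    unfolding h_def using q_add_cmult_left[OF f gH \<phi>, of c] qg[OF \<phi>] by (simp add: c_def)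
qed

definition max_dipole :: "('v, 'e) mg_point \<Rightarrow> ('v, 'e) mg_point \<Rightarrow> (('v, 'e) mg_point \<Rightarrow> real) \<Rightarrow> bool" where
  "max_dipole x y g \<longleftrightarrow> x \<in> points \<and> y \<in> points \<and> dipole x y g \<and>
    (\<forall>x'\<in>points. \<forall>y'\<in>points. \<exists>g'. dipole x' y' g' \<and> g' x' - g' y' \<le> g x - g y)"

text \<open>One pair that is separated by a function in \<open>H1\<close> suffices. The graph may
  have a single vertex with loops, so the midpoint of an edge is taken as one of the points.\<close>

lemma max_dipole_pos:
  assumes "max_dipole x y g"
  shows "0 < g x - g y"
proof -
  obtain e where e: "e \<in> arcs G" using arcs_nonempty by blast
  have "Inner e (len e / 2) \<in> points"
    unfolding points_def
    by (intro UnI2 CollectI exI[of _ e] exI[of _ "len e / 2"]) (use e len_pos[OF e] in simp)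
  moreover have "Vertex (tail G e) \<in> points"
    using e by (simp add: points_def)
  ultimately have p: "Inner e (len e / 2) \<in> points" "Vertex (tail G e) \<in> points" .
  obtain f where f: "f \<in> H1" "f (Inner e (len e / 2)) \<noteq> f (Vertex (tail G e))"
    by (rule H1_separates[OF p]) simp
  obtain g' where g': "dipole (Inner e (len e / 2)) (Vertex (tail G e)) g'"
    "g' (Inner e (len e / 2)) - g' (Vertex (tail G e)) \<le> g x - g y"
    using assms p unfolding max_dipole_def by blast
  have "0 < (f (Inner e (len e / 2)) - f (Vertex (tail G e)))\<^sup>2" using f(2) by simp
  also have "\<dots> \<le> (g' (Inner e (len e / 2)) - g' (Vertex (tail G e))) * q f f"
    using g'(1) f(1) by (rule dipole_bound)
  finally show ?thesis
    using g'(2) q_nonneg[of f] by (auto simp: zero_less_mult_iff)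
qed

lemma max_dipole_neq: "max_dipole x y g \<Longrightarrow> x \<noteq> y"
  using max_dipole_pos[of x y g] by auto

lemma max_dipole_bound:
  assumes "max_dipole x y g" "f \<in> H1" "p \<in> points" "p' \<in> points"
  shows "(f p - f p')\<^sup>2 \<le> (g x - g y) * q f f"
proof -
  obtain g' where g': "dipole p p' g'" "g' p - g' p' \<le> g x - g y"
    using assms unfolding max_dipole_def by blast
  have "(f p - f p')\<^sup>2 \<le> (g' p - g' p') * q f f" using g'(1) assms(2) by (rule dipole_bound)
  also have "\<dots> \<le> (g x - g y) * q f f" using g'(2) q_nonneg by (rule mult_right_mono)
  finally show ?thesis .
qed

subsection \<open>The first nonzero eigenvalue\<close>

text \<open>The Bhatia-Davis inequality for a variable of mean 0. The first claim keeps the exact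
  defect, whose vanishing describes the case of equality.\<close>

lemma eigenfunction_range:
  assumes \<mu>: "\<mu> \<in> borel_prob_measures" and f: "f \<in> eigenspace \<mu> s" "s \<noteq> 0"
    and ab: "\<And>p. p \<in> points \<Longrightarrow> b \<le> f p \<and> f p \<le> a"
  shows "(\<integral>p. (a - f p) * (f p - b) \<partial>\<mu>) = - a * b - (\<integral>p. (f p)\<^sup>2 \<partial>\<mu>)"
    and "(\<integral>p. (f p)\<^sup>2 \<partial>\<mu>) \<le> - a * b"
    and "integrable \<mu> (\<lambda>p. (a - f p) * (f p - b))"
proof -
  interpret prob_space \<mu> using \<mu> by (simp add: borel_prob_measures_def)
  note D = eigenspaceD[OF \<mu> f(1)]
  have L2: "f \<in> L2 \<mu>" using H1_L2[OF \<mu> D(2)] .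
  have int: "integrable \<mu> f" "integrable \<mu> (\<lambda>p. (f p)\<^sup>2)"
    using L2_integrable[OF L2] L2 by (simp_all add: L2_def)
  have eq: "(\<lambda>p. (a - f p) * (f p - b)) = (\<lambda>p. (a + b) * f p - (f p)\<^sup>2 - a * b)"
    by (simp add: fun_eq_iff power2_eq_square algebra_simps)
  show "integrable \<mu> (\<lambda>p. (a - f p) * (f p - b))" unfolding eq using int by simp
  show 1: "(\<integral>p. (a - f p) * (f p - b) \<partial>\<mu>) = - a * b - (\<integral>p. (f p)\<^sup>2 \<partial>\<mu>)"
    unfolding eq using int D(4) f(2) by (simp add: prob_space)
  have "0 \<le> (\<integral>p. (a - f p) * (f p - b) \<partial>\<mu>)"
    using ab space_borel_prob[OF \<mu>] by (intro Bochner_Integration.integral_nonneg) auto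
  with 1 show "(\<integral>p. (f p)\<^sup>2 \<partial>\<mu>) \<le> - a * b" by simp
qed

text \<open>The constant 4 enters through - a b \<le> (a - b)^2 / 4 for the extreme values a and b,
  which is an equality exactly for b = - a.\<close>

lemma eigenvalue_ge:
  assumes m: "max_dipole x y g" and \<mu>: "\<mu> \<in> borel_prob_measures"
    and s: "eigen_mult \<mu> s \<noteq> 0" "s \<noteq> 0"
  shows "4 / (g x - g y) \<le> s"
proof -
  obtain f where f: "f \<in> eigenspace \<mu> s" "f \<noteq> (\<lambda>_. 0)"
    using real_fun_dim_neq_0 s(1) unfolding eigen_mult_def by blast
  note D = eigenspaceD[OF \<mu> f(1)]
  obtain x1 where x1: "x1 \<in> points" "\<And>p. p \<in> points \<Longrightarrow> f p \<le> f x1" using H1_attains_max[OF D(2)] by metis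
  obtain x2 where x2: "x2 \<in> points" "\<And>p. p \<in> points \<Longrightarrow> f x2 \<le> f p" using H1_attains_min[OF D(2)] by metis
  let ?V = "\<integral>p. (f p)\<^sup>2 \<partial>\<mu>"
  have "?V \<le> - f x1 * f x2" using x1 x2 by (intro eigenfunction_range[OF \<mu> f(1) s(2)]) auto
  also have "\<dots> \<le> (f x1 - f x2)\<^sup>2 / 4"
    using zero_le_power2[of "f x1 + f x2"] by (simp add: power2_eq_square algebra_simps)
  also have "\<dots> \<le> (g x - g y) * q f f / 4"
    using max_dipole_bound[OF m D(2) x1(1) x2(1)] by simp
  also have "q f f = s * ?V" using D(3)[OF D(1)] by (simp add: power2_eq_square)
  finally have "?V * 1 \<le> ?V * ((g x - g y) * s / 4)" by (simp add: algebra_simps)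
  then have "1 \<le> (g x - g y) * s / 4"
    using integral_square_pos[OF \<mu> f] by (simp only: mult_le_cancel_left_pos)
  then show ?thesis using max_dipole_pos[OF m] by (simp add: field_simps)
qed

theorem eigenvalue_eq_imp_half_dirac_sum:
  assumes m: "max_dipole x y g" and \<mu>: "\<mu> \<in> borel_prob_measures"
    and s: "eigen_mult \<mu> s \<noteq> 0" "s = 4 / (g x - g y)"
  shows "\<exists>x1\<in>points. \<exists>x2\<in>points. x1 \<noteq> x2 \<and> \<mu> = half_dirac_sum x1 x2"
proof -
  interpret prob_space \<mu> using \<mu> by (simp add: borel_prob_measures_def)
  have sets_\<mu>: "sets \<mu> = sets mg_borel" using \<mu> by (simp add: borel_prob_measures_def)
  define M where "M = g x - g y"
  have M: "0 < M" unfolding M_def using m by (rule max_dipole_pos)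
  have s0: "s \<noteq> 0" using M s by (simp add: M_def)
  obtain f where f: "f \<in> eigenspace \<mu> s" "f \<noteq> (\<lambda>_. 0)"
    using real_fun_dim_neq_0 s(1) unfolding eigen_mult_def by blast
  note D = eigenspaceD[OF \<mu> f(1)]
  obtain x1 where x1: "x1 \<in> points" "\<And>p. p \<in> points \<Longrightarrow> f p \<le> f x1" using H1_attains_max[OF D(2)] by metis
  obtain x2 where x2: "x2 \<in> points" "\<And>p. p \<in> points \<Longrightarrow> f x2 \<le> f p" using H1_attains_min[OF D(2)] by metis
  let ?V = "\<integral>p. (f p)\<^sup>2 \<partial>\<mu>"
  have V: "0 < ?V" using \<mu> f by (rule integral_square_pos)
  note range = eigenfunction_range[OF \<mu> f(1) s0, of "f x2" "f x1"]
  have "q f f = s * ?V" using D(3)[OF D(1)] by (simp add: power2_eq_square)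
  then have qV: "M * q f f = 4 * ?V" using M s by (simp add: M_def)
  have le: "?V \<le> - f x1 * f x2" "(f x1 - f x2)\<^sup>2 \<le> 4 * ?V"
    using range(2) x1 x2 max_dipole_bound[OF m D(2) x1(1) x2(1)] qV by (auto simp: M_def)
  have "(f x1 + f x2)\<^sup>2 = (f x1 - f x2)\<^sup>2 + 4 * (f x1 * f x2)"
    by (simp add: power2_eq_square algebra_simps)
  \<comment> \<open>The bound by the range and the bound by the energy meet at the same integral,
    which leaves no room for an asymmetric range.\<close>
  then have "(f x1 + f x2)\<^sup>2 \<le> 0" using le by simp
  then have anti: "f x2 = - f x1" by simp
  then have f_x1: "f x1 \<noteq> 0" using le(1) V by auto
  have V_eq: "?V = - f x1 * f x2"
    using le anti by (simp add: power2_eq_square)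
  have two_values: "AE p in \<mu>. f p = f x1 \<or> f p = f x2"
  proof -
    have "(\<integral>p. (f x1 - f p) * (f p - f x2) \<partial>\<mu>) = 0" using range(1) x1 x2 V_eq by simp
    then have "AE p in \<mu>. (f x1 - f p) * (f p - f x2) = 0"
      using range(3) x1 x2 space_borel_prob[OF \<mu>]
      by (subst (asm) integral_nonneg_eq_0_iff_AE) auto
    then show ?thesis by eventually_elim auto
  qed
  \<comment> \<open>Every pair of a maximal and a minimal point has the same gap, whose square is
    \<open>M * q f f\<close>; the dipole bound then forces the resistance of the pair up to
    \<open>M\<close>, and the equality case determines \<open>q f\<close>. Keeping both points
    arbitrary allows exchanging one at a time.\<close>
  have flux: "q f \<phi> = (f x1 - f x2) / M * (\<phi> p1 - \<phi> p2)"
    if p: "p1 \<in> points" "p2 \<in> points" "f p1 = f x1" "f p2 = f x2" and \<phi>: "\<phi> \<in> H1" for p1 p2 \<phi>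
  proof -
    obtain g' where g': "dipole p1 p2 g'" "g' p1 - g' p2 \<le> M"
      using m p unfolding max_dipole_def M_def by blast
    have "M * q f f = (f p1 - f p2)\<^sup>2"
      unfolding p(3,4) qV V_eq anti by (simp add: power2_eq_square)
    moreover have "(f p1 - f p2)\<^sup>2 \<le> (g' p1 - g' p2) * q f f" using g'(1) D(2) by (rule dipole_bound)
    moreover have "0 < q f f" using qV V M by (metis mult_pos_pos zero_less_mult_pos zero_less_numeral)
    ultimately have "M \<le> g' p1 - g' p2" by (metis mult_le_cancel_right_pos)
    then have "g' p1 - g' p2 = M" using g'(2) by simp
    moreover have "(f p1 - f p2)\<^sup>2 = M * q f f"
      unfolding p(3,4) qV V_eq anti by (simp add: power2_eq_square)
    ultimately show ?thesis
      using dipole_bound_eq[OF g'(1) _ D(2) _ \<phi>] M p by simp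
  qed
  have nz: "(f x1 - f x2) / M \<noteq> 0" using anti f_x1 M by simp
  \<comment> \<open>For a second maximal point, the two flux formulas would give \<phi> p = \<phi>
    x1 for every \<phi>.\<close>
  have max_unique: "p = x1" if p: "p \<in> points" "f p = f x1" for p
  proof (rule ccontr)
    assume "p \<noteq> x1"
    with p(1) x1(1) obtain \<phi> where \<phi>: "\<phi> \<in> H1" "\<phi> p \<noteq> \<phi> x1" by (rule H1_separates)
    then show False
      using flux[OF p(1) x2(1) p(2) refl \<phi>(1)] flux[OF x1(1) x2(1) refl refl \<phi>(1)] nz \<phi>(2) by simp
  qed
  have min_unique: "p = x2" if p: "p \<in> points" "f p = f x2" for p
  proof (rule ccontr)
    assume "p \<noteq> x2"
    with p(1) x2(1) obtain \<phi> where \<phi>: "\<phi> \<in> H1" "\<phi> p \<noteq> \<phi> x2" by (rule H1_separates)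
    then show False
      using flux[OF x1(1) p(1) refl p(2) \<phi>(1)] flux[OF x1(1) x2(1) refl refl \<phi>(1)] nz \<phi>(2) by simp
  qed
  have ae: "AE p in \<mu>. p \<in> {x1, x2}"
    using two_values AE_space[of \<mu>]
    by eventually_elim (use max_unique min_unique in \<open>auto simp: space_borel_prob[OF \<mu>]\<close>)
  have neq: "x1 \<noteq> x2" using anti f_x1 by auto
  note two = integral_two_points[OF _ _ neq ae]
  have sing: "{x1} \<in> sets \<mu>" "{x2} \<in> sets \<mu>"
    using singleton_in_sets x1 x2 sets_\<mu> by auto
  \<comment> \<open>Total mass 1 and mean 0 are two linear equations for the weights; the opposite
    values of \<open>f\<close> make the weights equal.\<close>
  have "prob {x1} + prob {x2} = 1"
    using two[OF sing, of "\<lambda>_. 1"] by (simp add: prob_space)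
  moreover have "f x1 * prob {x1} + f x2 * prob {x2} = 0"
    using two[OF sing H1_measurable[OF \<mu> D(2)]] D(4) s0 by simp
  then have "f x1 * (prob {x1} - prob {x2}) = 0" using anti by (simp add: algebra_simps)
  then have "prob {x1} = prob {x2}" using f_x1 by simp
  ultimately have half: "prob {x1} = 1 / 2" "prob {x2} = 1 / 2" by auto
  have "\<mu> = half_dirac_sum x1 x2"
  proof (rule measure_eqI)
    show "sets \<mu> = sets (half_dirac_sum x1 x2)" using sets_\<mu> by (simp add: sets_half_dirac_sum)
    fix A assume A: "A \<in> sets \<mu>"
    have "prob A = (\<integral>p. indicator A p \<partial>\<mu>)" using A by simp
    also have "\<dots> = indicator A x1 * (1 / 2) + indicator A x2 * (1 / 2)"
      using two[OF sing, of "indicator A"] A half by simp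
    finally have "emeasure \<mu> A = ennreal (indicator A x1 * (1 / 2) + indicator A x2 * (1 / 2))"
      by (simp add: emeasure_eq_measure)
    also have "\<dots> = emeasure (half_dirac_sum x1 x2) A"
      using A sets_\<mu> by (simp add: emeasure_half_dirac_sum_ennreal add_divide_distrib)
    finally show "emeasure \<mu> A = emeasure (half_dirac_sum x1 x2) A" .
  qed
  then show ?thesis using x1 x2 neq by blast
qed

section \<open>Two-point measures: support, integral and first nonzero eigenvalue\<close>

lemma half_dirac_sum_supp:
  assumes "x \<in> points" "y \<in> points"
  shows "{x, y} \<subseteq> supp (half_dirac_sum x y)"
proof -
  have "0 < emeasure (half_dirac_sum x y) U" if "openin mg_topology U" "x \<in> U \<or> y \<in> U" for U
    using that openin_imp_sets by (auto simp: emeasure_half_dirac_sum_ennreal indicator_def)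
  then show ?thesis using assms by (auto simp: supp_def)
qed

lemma integral_half_dirac_sum:
  fixes h :: "('v, 'e) mg_point \<Rightarrow> real"
  assumes "x \<in> points" "y \<in> points" "x \<noteq> y" and h: "h \<in> borel_measurable (half_dirac_sum x y)"
  shows "(\<integral>p. h p \<partial>half_dirac_sum x y) = (h x + h y) / 2"
proof -
  let ?\<mu> = "half_dirac_sum x y"
  interpret prob_space ?\<mu>
    using half_dirac_sum_borel_prob[OF assms(1,2)] by (simp add: borel_prob_measures_def)
  have sing: "{x} \<in> sets ?\<mu>" "{y} \<in> sets ?\<mu>"
    using singleton_in_sets assms by (simp_all add: sets_half_dirac_sum)
  have "points \<in> sets mg_borel" using sets.top[of mg_borel] by (simp add: space_mg_borel)
  then have "points - {x} - {y} \<in> sets mg_borel"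
    using sing by (intro sets.Diff) (simp_all add: sets_half_dirac_sum)
  then have "points - {x} - {y} \<in> null_sets ?\<mu>"
    by (simp add: null_sets_def sets_half_dirac_sum emeasure_half_dirac_sum_ennreal)
  then have ae: "AE p in ?\<mu>. p \<in> {x, y}"
    using space_borel_prob[OF half_dirac_sum_borel_prob[OF assms(1,2)]]
    by (intro AE_I'[of "points - {x} - {y}"]) auto
  have half: "measure ?\<mu> {x} = 1 / 2" "measure ?\<mu> {y} = 1 / 2"
    using sing assms(3) by (simp_all add: sets_half_dirac_sum measure_half_dirac_sum)
  show ?thesis
    unfolding integral_two_points[OF sing assms(3) ae h] half by simp
qed

theorem eigenvalue_half_dirac_sum:
  assumes m: "max_dipole x y g"
  shows "eigenvalue 1 (half_dirac_sum x y) = ereal (4 / (g x - g y))"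
proof -
  let ?\<mu> = "half_dirac_sum x y"
  define M where "M = g x - g y"
  have xy: "x \<in> points" "y \<in> points" and g: "dipole x y g" using m by (auto simp: max_dipole_def)
  have M: "0 < M" unfolding M_def using m by (rule max_dipole_pos)
  have neq: "x \<noteq> y" using m by (rule max_dipole_neq)
  have \<mu>: "?\<mu> \<in> borel_prob_measures" using xy by (rule half_dirac_sum_borel_prob)
  note int = integral_half_dirac_sum[OF xy neq]
  have meas: "(\<lambda>p. u p * v p) \<in> borel_measurable ?\<mu>" if "u \<in> H1" "v \<in> H1" for u v
    using H1_measurable[OF \<mu>] that by (intro borel_measurable_times) auto
  \<comment> \<open>The shift balances the values at \<open>x\<close> and \<open>y\<close> to M / 2
    and - M / 2, which gives the mean 0 that an eigenfunction of a nonzero eigenvalue must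
    have.\<close>
  define f where "f = (\<lambda>p. g p + (- (g x + g y) / 2) * one p)"
  have gH: "g \<in> H1" using g by (simp add: dipole_def)
  have f: "f \<in> H1" unfolding f_def using gH one_H1 by (rule H1_add_cmult)
  have f_xy: "f x = M / 2" "f y = - M / 2"
    using xy by (simp_all add: f_def one_eq M_def field_simps)
  have qf: "q f \<phi> = \<phi> x - \<phi> y" if "\<phi> \<in> H1" for \<phi>
    unfolding f_def q_add_cmult_left[OF gH one_H1 that] q_one(1)[OF that]
    using g that by (simp add: dipole_def)
  \<comment> \<open>A test function that vanishes on the support vanishes at \<open>x\<close> and
    \<open>y\<close>, the only points that enter \<open>q f\<close>.\<close>
  have f_on: "f \<in> H1_on ?\<mu>"
    using f qf half_dirac_sum_supp[OF xy] xy by (auto simp: H1_on_def harmonic_on_def)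
  have f_eig: "f \<in> eigenspace ?\<mu> (4 / M)"
  proof (rule eigenspaceI[OF \<mu> f_on])
    fix \<phi> assume "\<phi> \<in> H1_on ?\<mu>"
    then have \<phi>: "\<phi> \<in> H1" by (simp add: H1_on_def)
    \<comment> \<open>The integral is M / 4 times the difference \<phi> x - \<phi> y.\<close>
    show "q f \<phi> = 4 / M * (\<integral>p. f p * \<phi> p \<partial>?\<mu>)"
      unfolding qf[OF \<phi>] int[OF meas[OF f \<phi>]] f_xy using M by (simp add: field_simps)
  qed
  have "eigenspace ?\<mu> (4 / M) = range (\<lambda>c p. c * f p)"
  proof
    have "(\<lambda>p. c * f p) \<in> eigenspace ?\<mu> (4 / M)" for c
      using eigenspace_add_cmult[OF \<mu> f_eig f_eig, of "c - 1"] by (simp add: algebra_simps)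
    then show "range (\<lambda>c p. c * f p) \<subseteq> eigenspace ?\<mu> (4 / M)" by blast
    show "eigenspace ?\<mu> (4 / M) \<subseteq> range (\<lambda>c p. c * f p)"
    proof
      fix u assume u: "u \<in> eigenspace ?\<mu> (4 / M)"
      note U = eigenspaceD[OF \<mu> u]
      have u_xy: "u x + u y = 0"
        using U(4) int[OF H1_measurable[OF \<mu> U(2)]] M by simp
      \<comment> \<open>The coefficient makes \<open>d\<close> vanish at \<open>x\<close>, and mean
        0 then makes it vanish at \<open>y\<close>. Without mass at the two atoms it has no energy,
        so it is constant and hence 0.\<close>
      define d where "d = (\<lambda>p. u p + (- (2 * u x / M)) * f p)"
      have d: "d \<in> eigenspace ?\<mu> (4 / M)"
        unfolding d_def using \<mu> u f_eig by (rule eigenspace_add_cmult)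
      note D = eigenspaceD[OF \<mu> d]
      have d_xy: "d x = 0" "d y = 0"
        using u_xy M by (simp_all add: d_def f_xy)
      have "q d d = 0"
        using D(3)[OF D(1)] int[OF meas[OF D(2) D(2)]] by (simp add: d_xy)
      then have "d = (\<lambda>p. d x * one p)" by (intro H1_constant D xy)
      then have d0: "d p = 0" for p using d_xy by (metis mult_zero_left)
      have "u p = (2 * u x / M) * f p" for p using d0[of p] by (simp add: d_def)
      then have "u = (\<lambda>p. (2 * u x / M) * f p)" by (rule ext)
      then show "u \<in> range (\<lambda>c p. c * f p)" by (rule range_eqI)
    qed
  qed
  moreover have f_neq: "f \<noteq> (\<lambda>_. 0)" using f_xy M by auto
  ultimately have mult: "eigen_mult ?\<mu> (4 / M) = 1"
    unfolding eigen_mult_def using real_fun_dim_range by metis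
  have ge: "4 / M \<le> s" if "eigen_mult ?\<mu> s \<noteq> 0" "s \<noteq> 0" for s
    unfolding M_def using m \<mu> that by (rule eigenvalue_ge)
  \<comment> \<open>The count must be exactly 2 here: 1 from the constants and 1 from
    \<open>f\<close>, with every other eigenvalue excluded by \<open>ge\<close>.\<close>
  have "{s. s \<le> 4 / M \<and> eigen_mult ?\<mu> s \<noteq> 0} = {0, 4 / M}"
    using ge eigen_mult_0[OF \<mu>] mult M by force
  then have count: "eigenvalue_count ?\<mu> (4 / M) = 2"
    using M eigen_mult_0[OF \<mu>] mult by (simp add: eigenvalue_count_def)
  have inf: "Inf {ereal r | r. 1 < eigenvalue_count ?\<mu> r} = ereal (4 / M)"
  proof (rule antisym)
    show "Inf {ereal r | r. 1 < eigenvalue_count ?\<mu> r} \<le> ereal (4 / M)"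
      using count by (intro Inf_lower) auto
    show "ereal (4 / M) \<le> Inf {ereal r | r. 1 < eigenvalue_count ?\<mu> r}"
    proof (rule Inf_greatest)
      fix z assume "z \<in> {ereal r | r. 1 < eigenvalue_count ?\<mu> r}"
      then obtain r where r: "z = ereal r" "1 < eigenvalue_count ?\<mu> r" by blast
      then obtain s where "s \<le> r" "s \<noteq> 0" "eigen_mult ?\<mu> s \<noteq> 0"
        using eigenvalue_count_gt_1(2)[OF \<mu>] by blast
      then show "ereal (4 / M) \<le> z" using ge[of s] r by simp
    qed
  qed
  \<comment> \<open>This rules out the branch of \<open>eigenvalue\<close> with value \<infinity>.
    Independence of \<open>one\<close> and \<open>f\<close> is tested at the two atoms, where they
    take the values 1, 1 and M / 2, - M / 2.\<close>
  have "enat 2 \<le> L2_dim ?\<mu>"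
    unfolding L2_dim_def
  proof (rule Sup_upper, rule CollectI, intro exI conjI allI impI)
    let ?F = "\<lambda>i :: nat. if i = 0 then one else f"
    show "?F i \<in> L2 ?\<mu>" for i using H1_L2[OF \<mu>] one_H1 f by simp
    fix c :: "nat \<Rightarrow> real" and i :: nat
    assume ae: "AE p in ?\<mu>. (\<Sum>i<2. c i * ?F i p) = 0" and i: "i < 2"
    have sum: "(\<Sum>i<2. c i * ?F i p) = c 0 * one p + c 1 * f p" for p
      by (simp add: numeral_2_eq_2)
    have h: "(\<lambda>p. c 0 * one p + c 1 * f p) \<in> borel_measurable ?\<mu>"
      using H1_measurable[OF \<mu>] one_H1 f by (intro borel_measurable_add borel_measurable_times) auto
    have "(\<integral>p. (c 0 * one p + c 1 * f p)\<^sup>2 \<partial>?\<mu>) = 0"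
      using ae by (intro integral_eq_zero_AE) (simp add: sum)
    then have "(c 0 * one x + c 1 * f x)\<^sup>2 + (c 0 * one y + c 1 * f y)\<^sup>2 = 0"
      using int[OF borel_measurable_power[OF h, of 2]] by simp
    then have "c 0 + c 1 * (M / 2) = 0" "c 0 - c 1 * (M / 2) = 0"
      using xy by (simp_all add: sum_power2_eq_zero_iff one_eq f_xy)
    then have "c 0 = 0" "c 1 * M = 0" by linarith+
    then have "c 0 = 0" "c 1 = 0" using M by simp_all
    then show "c i = 0" using i by (auto simp: less_2_cases_iff)
  qed (rule refl)
  then have "\<not> L2_dim ?\<mu> \<le> enat 1"
    by (metis enat_ord_simps(1) order_trans one_less_numeral_iff not_le semiring_norm(76))
  then show ?thesis
    using inf by (simp add: eigenvalue_def M_def)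
qed

section \<open>The infimum over all measures\<close>

lemma eigenvalue_1_ge:
  assumes m: "max_dipole x y g" and \<mu>: "\<mu> \<in> borel_prob_measures"
  shows "ereal (4 / (g x - g y)) \<le> eigenvalue 1 \<mu>"
proof -
  have "ereal (4 / (g x - g y)) \<le> Inf {ereal r | r. 1 < eigenvalue_count \<mu> r}"
  proof (rule Inf_greatest)
    fix z assume "z \<in> {ereal r | r. 1 < eigenvalue_count \<mu> r}"
    then obtain r where r: "z = ereal r" "1 < eigenvalue_count \<mu> r" by blast
    then obtain s where "s \<le> r" "s \<noteq> 0" "eigen_mult \<mu> s \<noteq> 0"
      using eigenvalue_count_gt_1(2)[OF \<mu>] by blast
    then show "ereal (4 / (g x - g y)) \<le> z" using eigenvalue_ge[OF m \<mu>, of s] r by simp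
  qed
  then show ?thesis by (simp add: eigenvalue_def)
qed

text \<open>The infimum in \<open>eigenvalue\<close> ranges over real bounds, so an actual
  eigenvalue has to be extracted. A finite value makes the set of bounds nonempty, the nonzero
  eigenvalues up to one such bound form a finite nonempty set, and their minimum lies below every
  other bound.\<close>

lemma eigenvalue_1_attained:
  assumes \<mu>: "\<mu> \<in> borel_prob_measures" and fin: "eigenvalue 1 \<mu> \<noteq> \<infinity>"
  obtains s where "s \<noteq> 0" "eigen_mult \<mu> s \<noteq> 0" "ereal s \<le> eigenvalue 1 \<mu>"
proof -
  have eq: "eigenvalue 1 \<mu> = Inf {ereal r | r. 1 < eigenvalue_count \<mu> r}"
    using fin by (auto simp: eigenvalue_def split: if_splits)
  have "\<exists>r. 1 < eigenvalue_count \<mu> r"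
  proof (rule ccontr)
    assume "\<not> ?thesis"
    then have "{ereal r | r. 1 < eigenvalue_count \<mu> r} = {}" by blast
    then show False using fin eq by (simp add: top_ereal_def)
  qed
  then obtain r where r: "1 < eigenvalue_count \<mu> r" by blast
  define T where "T = {s. s \<le> r \<and> eigen_mult \<mu> s \<noteq> 0} - {0}"
  have T: "finite T" "T \<noteq> {}"
    using eigenvalue_count_gt_1[OF \<mu> r] by (auto simp: T_def)
  have "Min T \<in> T" using T by (rule Min_in)
  moreover have "ereal (Min T) \<le> Inf {ereal r | r. 1 < eigenvalue_count \<mu> r}"
  proof (rule Inf_greatest)
    fix z assume "z \<in> {ereal r | r. 1 < eigenvalue_count \<mu> r}"
    then obtain r' where r': "z = ereal r'" "1 < eigenvalue_count \<mu> r'" by blast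
    then obtain s where s: "s \<le> r'" "s \<noteq> 0" "eigen_mult \<mu> s \<noteq> 0"
      using eigenvalue_count_gt_1(2)[OF \<mu>] by blast
    have "Min T \<le> r'"
    proof (cases "s \<le> r")
      case True
      then show ?thesis using Min_le[OF T(1), of s] s by (simp add: T_def)
    next
      \<comment> \<open>Here \<open>Min T \<le> r < s \<le> r'\<close>.\<close>
      case False
      then show ?thesis using \<open>Min T \<in> T\<close> s by (simp add: T_def)
    qed
    then show "ereal (Min T) \<le> z" using r' by simp
  qed
  ultimately show ?thesis using that[of "Min T"] eq by (auto simp: T_def)
qed

theorem first_eigenvalue_minimizers:
  "(\<exists>x\<in>points. \<exists>y\<in>points. x \<noteq> y \<and> eigenvalue_min 1 = eigenvalue 1 (half_dirac_sum x y)) \<and>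
   (\<forall>\<mu>\<in>borel_prob_measures. eigenvalue_min 1 = eigenvalue 1 \<mu> \<longrightarrow>
     (\<exists>x\<in>points. \<exists>y\<in>points. x \<noteq> y \<and> \<mu> = half_dirac_sum x y))"
proof -
  obtain x y g where m: "max_dipole x y g"
    using exists_max_dipole unfolding max_dipole_def by metis
  then have xy: "x \<in> points" "y \<in> points" by (auto simp: max_dipole_def)
  let ?r = "4 / (g x - g y)"
  have min: "eigenvalue_min 1 = ereal ?r"
    unfolding eigenvalue_min_def
  proof (rule antisym)
    show "(INF \<mu>\<in>borel_prob_measures. eigenvalue 1 \<mu>) \<le> ereal ?r"
      using INF_lower[OF half_dirac_sum_borel_prob[OF xy], of "eigenvalue 1"]
      unfolding eigenvalue_half_dirac_sum[OF m] .
  qed (rule INF_greatest, rule eigenvalue_1_ge[OF m])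
  show ?thesis
  proof (intro conjI ballI impI)
    show "\<exists>x\<in>points. \<exists>y\<in>points. x \<noteq> y \<and> eigenvalue_min 1 = eigenvalue 1 (half_dirac_sum x y)"
      using xy max_dipole_neq[OF m] eigenvalue_half_dirac_sum[OF m] min by metis
    fix \<mu> assume \<mu>: "\<mu> \<in> borel_prob_measures" and eq: "eigenvalue_min 1 = eigenvalue 1 \<mu>"
    then obtain s where s: "s \<noteq> 0" "eigen_mult \<mu> s \<noteq> 0" "ereal s \<le> ereal ?r"
      using eigenvalue_1_attained[OF \<mu>] min by (metis PInfty_neq_ereal(1))
    \<comment> \<open>The eigenvalue extracted from the minimum is squeezed onto the lower bound,
      which is the case of equality.\<close>
    then have "s = ?r" using eigenvalue_ge[OF m \<mu>, of s] by simp
    then show "\<exists>x\<in>points. \<exists>y\<in>points. x \<noteq> y \<and> \<mu> = half_dirac_sum x y"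
      using eigenvalue_eq_imp_half_dirac_sum[OF m \<mu> s(2)] by blast
  qed
qed

end

theorem theorem5p1:
  fixes G :: "('v, 'e) pre_digraph" and len :: "'e \<Rightarrow> real"
  assumes "metric_graph G len"
  shows "(\<exists>x \<in> metric_graph.points G len. \<exists>y \<in> metric_graph.points G len. x \<noteq> y \<and>
            metric_graph.eigenvalue_min G len 1 =
              metric_graph.eigenvalue G len 1 (metric_graph.half_dirac_sum G len x y)) \<and>
         (\<forall>\<mu> \<in> metric_graph.borel_prob_measures G len.
            metric_graph.eigenvalue_min G len 1 = metric_graph.eigenvalue G len 1 \<mu> \<longrightarrow>
              (\<exists>x \<in> metric_graph.points G len. \<exists>y \<in> metric_graph.points G len. x \<noteq> y \<and>
                 \<mu> = metric_graph.half_dirac_sum G len x y))"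
  using metric_graph.first_eigenvalue_minimizers[OF assms] .

end
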